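(* Let $G$ be a group, let $1\le n\le 4$, and let $(a_1,\ldots,a_n)$ be an $n$-tuple of positive integers which is $G$-harmonic. Then $(a_1,\ldots,a_n)$ is also $\mathbb{Z}$-harmonic.
   Context: For a group $G$ (not necessarily finite), an $n$-tuple of positive integers $(a_1,\ldots,a_n)$ is called $G$-harmonic if there exist subgroups $U_1,\ldots,U_n$ of $G$ and elements $g_1,\ldots,g_n\in G$ such that the left cosets $g_1U_1,\ldots,g_nU_n$ have pairwise trivial (i.e. empty) intersection and $[G:U_i]=a_i$ for all $1\le i\le n$. In particular, $(a_1,\ldots,a_n)$ is $\mathbb{Z}$-harmonic if there are integers $m_1,\ldots,m_n$ such that the arithmetic progressions $m_1+a_1\mathbb{Z},\ldots,m_n+a_n\mathbb{Z}$ are pairwise disjoint. *)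

theory Defs
  imports "HOL-Algebra.Algebra"
begin

(* Finiteness of the set of cosets is required explicitly because card is 0 on
   infinite sets. *)
definition harmonic :: "('g, 'b) monoid_scheme \<Rightarrow> nat list \<Rightarrow> bool" where
  "harmonic G a \<longleftrightarrow>
     (\<exists>(U :: nat \<Rightarrow> 'g set) (g :: nat \<Rightarrow> 'g).
        (\<forall>i<length a. subgroup (U i) G \<and> g i \<in> carrier G \<and>
           finite (lcosets\<^bsub>G\<^esub> (U i)) \<and> card (lcosets\<^bsub>G\<^esub> (U i)) = a ! i) \<and>
        (\<forall>i<length a. \<forall>j<length a. i \<noteq> j \<longrightarrow>
           (g i <#\<^bsub>G\<^esub> U i) \<inter> (g j <#\<^bsub>G\<^esub> U j) = {}))"

lemma l_coset_integer_group: "m <#\<^bsub>integer_group\<^esub> U = (\<lambda>x. m + x) ` U"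
  by (auto simp: l_coset_def integer_group_def)

lemma dvd_subgroup_integer_group: "subgroup (range (\<lambda>k::int. d * k)) integer_group"
proof (rule group.subgroupI[OF group_integer_group])
  fix x y assume "x \<in> range ((*) d)" "y \<in> range ((*) d)"
  then obtain k l where "x = d * k" "y = d * l" by auto
  then have "x + y = d * (k + l)" "- x = d * (- k)" by (simp_all add: distrib_left)
  then have "x + y \<in> range ((*) d)" "- x \<in> range ((*) d)" by blast+
  then show "inv\<^bsub>integer_group\<^esub> x \<in> range ((*) d)" "x \<otimes>\<^bsub>integer_group\<^esub> y \<in> range ((*) d)"
    by simp_all
qed auto

lemma card_lcosets_integer_group:
  assumes "n > 0"
  defines "L \<equiv> lcosets\<^bsub>integer_group\<^esub> (range (\<lambda>k::int. int n * k))"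
  shows "finite L" "card L = n"
proof -
  define c where "c m = (\<lambda>x. m + x) ` range (\<lambda>k::int. int n * k)" for m
  have c_iff: "x \<in> c m \<longleftrightarrow> int n dvd x - m" for x m
  proof
    assume "x \<in> c m" then show "int n dvd x - m" by (auto simp: c_def)
  next
    assume "int n dvd x - m"
    then obtain k where "x - m = int n * k" by (rule dvdE)
    then have "x = m + int n * k" by simp
    then show "x \<in> c m" by (auto simp: c_def)
  qed
  have c_eq: "c m = c (m mod int n)" for m
  proof -
    have "int n dvd x - m \<longleftrightarrow> int n dvd x - m mod int n" for x
      by (metis mod_eq_dvd_iff mod_mod_trivial)
    then have "x \<in> c m \<longleftrightarrow> x \<in> c (m mod int n)" for x by (simp only: c_iff)
    then show ?thesis by blast
  qed
  have "L = range c" unfolding L_def LCOSETS_def l_coset_integer_group c_def by auto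
  moreover have "range c \<subseteq> c ` {0..<int n}"
  proof
    fix Y assume "Y \<in> range c"
    then obtain m where "Y = c (m mod int n)" using c_eq by blast
    moreover have "m mod int n \<in> {0..<int n}" using assms by simp
    ultimately show "Y \<in> c ` {0..<int n}" by blast
  qed
  ultimately have L: "L = c ` {0..<int n}" by blast
  have "inj_on c {0..<int n}"
  proof (rule inj_onI)
    fix x y assume xy: "x \<in> {0..<int n}" "y \<in> {0..<int n}" "c x = c y"
    have "x \<in> c x" by (simp only: c_iff) simp
    then have "int n dvd x - y" using xy(3) c_iff by simp
    then have "x mod int n = y mod int n" by (simp only: mod_eq_dvd_iff)
    then show "x = y" using xy(1,2) by simp
  qed
  then show "card L = n" by (simp add: L card_image)
  show "finite L" by (simp add: L)
qed

lemma index_in_subgroup_integer_group: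
  assumes U: "subgroup U integer_group" and c: "card (lcosets\<^bsub>integer_group\<^esub> U) = n"
  shows "range (\<lambda>k::int. int n * k) \<subseteq> U"
proof -
  interpret comm_group integer_group by (rule abelian_integer_group)
  interpret N: normal U integer_group by (rule subgroup_imp_normal[OF U])
  have "lcosets\<^bsub>integer_group\<^esub> U = rcosets\<^bsub>integer_group\<^esub> U"
    using N.coset_eq by (auto simp: LCOSETS_def RCOSETS_def)
  then have o: "order (integer_group Mod U) = n"
    using c by (simp add: order_def FactGroup_def)
  interpret Q: group "integer_group Mod U" by (rule N.factorgroup_is_group)
  interpret h: group_hom integer_group "integer_group Mod U" "\<lambda>a. U #>\<^bsub>integer_group\<^esub> a"
    by unfold_locales (rule N.r_coset_hom_Mod)
  have "int n * k \<in> U" for k :: int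
  proof -
    have k: "U #>\<^bsub>integer_group\<^esub> k \<in> carrier (integer_group Mod U)"
      by (auto simp: FactGroup_def RCOSETS_def)
    have "(U #>\<^bsub>integer_group\<^esub> k) [^]\<^bsub>integer_group Mod U\<^esub> n = U"
      using Q.pow_order_eq_1[OF k] o by simp
    moreover have "(U #>\<^bsub>integer_group\<^esub> k) [^]\<^bsub>integer_group Mod U\<^esub> n
                   = U #>\<^bsub>integer_group\<^esub> (k [^]\<^bsub>integer_group\<^esub> n)"
      using h.hom_nat_pow[of k n] by simp
    moreover have "k [^]\<^bsub>integer_group\<^esub> n = int n * k"
      by simp
    ultimately show ?thesis using rcos_self[OF _ U, of "int n * k"] by auto
  qed
  then show ?thesis by auto
qed

lemma harmonic_integer_group_iff:
  assumes "\<forall>i<length a. a ! i > 0"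
  shows "harmonic integer_group a \<longleftrightarrow>
    (\<exists>m :: nat \<Rightarrow> int. \<forall>i<length a. \<forall>j<length a. i \<noteq> j \<longrightarrow>
       range (\<lambda>k. m i + int (a ! i) * k) \<inter> range (\<lambda>k. m j + int (a ! j) * k) = {})"
  (is "_ \<longleftrightarrow> ?R")
proof
  assume "harmonic integer_group a"
  then obtain U g where
    Ug: "\<forall>i<length a. subgroup (U i) integer_group \<and> g i \<in> carrier integer_group \<and>
      finite (lcosets\<^bsub>integer_group\<^esub> (U i)) \<and> card (lcosets\<^bsub>integer_group\<^esub> (U i)) = a ! i"
    and disj: "\<forall>i<length a. \<forall>j<length a. i \<noteq> j \<longrightarrow>
      (\<lambda>x. g i + x) ` U i \<inter> (\<lambda>x. g j + x) ` U j = {}"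
    unfolding harmonic_def l_coset_integer_group by (elim exE conjE)
  have sub: "range (\<lambda>k. g i + int (a ! i) * k) \<subseteq> (\<lambda>x. g i + x) ` U i" if "i < length a" for i
    using index_in_subgroup_integer_group[of "U i" "a ! i"] Ug that by auto
  have "range (\<lambda>k. g i + int (a ! i) * k) \<inter> range (\<lambda>k. g j + int (a ! j) * k) = {}"
    if "i < length a" "j < length a" "i \<noteq> j" for i j
    using Int_mono[OF sub[OF that(1)] sub[OF that(2)]] disj that by simp
  then show ?R by (intro exI[of _ g]) simp
next
  assume ?R
  then obtain m :: "nat \<Rightarrow> int" where m: "\<forall>i<length a. \<forall>j<length a. i \<noteq> j \<longrightarrow>
       range (\<lambda>k. m i + int (a ! i) * k) \<inter> range (\<lambda>k. m j + int (a ! j) * k) = {}" by blast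
  show "harmonic integer_group a"
    unfolding harmonic_def l_coset_integer_group
  proof (intro exI conjI allI impI)
    fix i assume i: "i < length a"
    then have "a ! i > 0" using assms by blast
    then show "finite (lcosets\<^bsub>integer_group\<^esub> (range (\<lambda>k. int (a ! i) * k)))"
      "card (lcosets\<^bsub>integer_group\<^esub> (range (\<lambda>k. int (a ! i) * k))) = a ! i"
      by (rule card_lcosets_integer_group)+
    show "subgroup (range (\<lambda>k. int (a ! i) * k)) integer_group"
      by (rule dvd_subgroup_integer_group)
    show "m i \<in> carrier integer_group" by simp
  next
    fix i j assume "i < length a" "j < length a" "i \<noteq> j"
    then show "(\<lambda>x. m i + x) ` range (\<lambda>k. int (a ! i) * k) \<inter>
        (\<lambda>x. m j + x) ` range (\<lambda>k. int (a ! j) * k) = {}"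
      unfolding image_image using m by blast
  qed
qed

end

theory Submission
  imports Defs "HOL-Number_Theory.Cong"
begin

text \<open>Write $d_{ij} = \gcd(a_i, a_j)$. The progressions $m_i + a_i \mathbb{Z}$ and $m_j + a_j \mathbb{Z}$ are disjoint
iff $d_{ij}$ does not divide $m_i - m_j$, so being harmonic over the integers depends on the $d_{ij}$ only. For four
entries without coprime pairs, the Chinese remainder theorem produces suitable $m_i$ except in three situations
(\<open>separating_residues\<close>): three entries have pairwise gcd 2; all six gcds are 3; three entries have pairwise gcd 4
and each has gcd 2 with the remaining entry. It remains to see that coprime pairs and these three situations
do not occur for disjoint cosets in a group.

The group acts on each finite set $\Omega_i$ of cosets of $U_i$ transitively, and the relation ``the cosets meet''
is invariant. The cosets $U_i$ themselves pairwise meet, as they share the identity, while the cosets $g_i U_i$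
pairwise do not. So the situation is symmetric in the relation and its complement: one family of cosets has all
pairs related, the other has no pair related (locale \<open>two_configurations\<close>). By transitivity the number of tuples in an
invariant set of tuples is divisible by every $|\Omega_i|$ involved, hence by their least common multiple.
If an invariant set is nonempty and has just this many elements, every invariant property holds for all of its
elements or for none (\<open>tight_constant\<close>). For small gcds, many sets of tuples prescribed by relations along the edges
of a tree are of this kind, and the two families then decide the relation on the other pairs.

For three gcds 2, the relation has density one half on each pair. The family of related cosets shows
that $x \sim y$ and $x \sim z$ imply $y \sim z$; the other family shows the same with $\not\sim$ throughout, and the
two laws are inconsistent.

For six gcds 3, on each pair either the relation or its complement has density one third; this 2-colours the edges
of the complete graph on four vertices. A vertex with three edges of one colour would
force every coset at this vertex to be related in that colour to a member of the family that avoids the colour. In the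
remaining colourings the density-one-third relations contain no triangle, and each 4-cycle is either closed by every
path of three edges or by none. Counting shows that among the two 4-cycles through two opposite edges at least one
is closed (\<open>one_of_two_cycles\<close>) and that not all three are (\<open>not_all_cycles_closed\<close>); the two families contradict this
for each colouring.

For the gcds 4, 4, 4, 2, 2, 2 every coset $v$ at the fourth index splits each $\Omega_i$ in halves. In each of the eight sectors
given by a choice of halves, at most one of the patterns ``all three related'' and ``no two related'' occurs
(\<open>not_both_triangles\<close>). From this one finds that, for the three cosets $U_i$, a coset $v$ meets all or exactly one of them;
as every $U_i$ meets half of the $2w$ cosets $v$, this makes $w$ even, so the gcds with the fourth entry would be divisible by 4.\<close>

hide_const (open) Divisibility.prime

section \<open>Separating residues modulo given gcds\<close>

text \<open>The moduli 8 and 9 are large enough for all choices at the primes 2 and 3 that are needed for four progressions.\<close>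

lemma residues_mod_8_9_and_large_primes:
  fixes u v w :: "nat \<Rightarrow> int" and N :: nat
  obtains m :: "nat \<Rightarrow> int" where "\<And>i. [m i = u i] (mod 8)" "\<And>i. [m i = v i] (mod 9)"
    "\<And>i p. prime p \<Longrightarrow> 5 \<le> p \<Longrightarrow> p \<le> N \<Longrightarrow> [m i = w i] (mod int p)"
proof -
  define P where "P = {p::nat. prime p \<and> 5 \<le> p \<and> p \<le> N}"
  define q :: int where "q = (\<Prod>p\<in>P. int p)"
  have fin: "finite P"
    by (rule finite_subset[of _ "{..N}"]) (auto simp: P_def)
  have cop_prime: "coprime (r ^ k) (int p)" if "p \<in> P" "r = 2 \<or> r = 3" for p k and r :: int
  proof -
    have p: "prime (int p)" "5 \<le> p" using that by (auto simp: P_def)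
    have "prime r" using that(2) by auto
    moreover have "r \<noteq> int p" using that(2) p by auto
    ultimately have "coprime r (int p)" using p(1) by (intro primes_coprime)
    then show ?thesis by simp
  qed
  have "coprime (2 ^ 3) q"
    unfolding q_def by (rule prod_coprime_right, rule cop_prime) simp_all
  moreover have "coprime (3 ^ 2) q"
    unfolding q_def by (rule prod_coprime_right, rule cop_prime) simp_all
  ultimately have cop: "coprime 8 q" "coprime 9 q" by simp_all
  have "coprime (2 ^ 3) (3 ^ 2 :: int)"
    by (intro coprime_power_left_iff[THEN iffD2] coprime_power_right_iff[THEN iffD2] disjI1 primes_coprime) auto
  then have cop89: "coprime 8 (9::int)" by simp
  then have "coprime (8 * 9) q" using cop by (simp only: coprime_mult_left_iff)
  have "\<exists>x. [x = u i] (mod 8) \<and> [x = v i] (mod 9) \<and> [x = w i] (mod q)" for i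
  proof -
    obtain y where y: "[y = u i] (mod 8)" "[y = v i] (mod 9)"
      using binary_chinese_remainder_int[OF cop89] by blast
    obtain x where x: "[x = y] (mod 8 * 9)" "[x = w i] (mod q)"
      using binary_chinese_remainder_int[OF \<open>coprime (8 * 9) q\<close>] by blast
    have "[x = y] (mod 8)" "[x = y] (mod 9)"
      using x(1) by (rule cong_dvd_modulus, simp)+
    then show ?thesis using y x(2) cong_trans by blast
  qed
  then obtain m where m: "\<And>i. [m i = u i] (mod 8) \<and> [m i = v i] (mod 9) \<and> [m i = w i] (mod q)"
    by metis
  have "[m i = w i] (mod int p)" if "prime p" "5 \<le> p" "p \<le> N" for i p
  proof (rule cong_dvd_modulus)
    show "[m i = w i] (mod q)" using m by blast
    show "int p dvd q" unfolding q_def by (rule dvd_prodI[OF fin]) (use that in \<open>simp add: P_def\<close>)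
  qed
  then show thesis using m by (intro that) blast+
qed

lemma labelling_of_four:
  assumes "distinct [i, j, k, l]" "{i, j, k, l} = {..<4::nat}"
    and sym: "\<And>x y. P x y \<Longrightarrow> P y x"
    and "P i j" "P i k" "P i l" "P j k" "P j l" "P k l"
  shows "\<forall>x<4. \<forall>y<4. x \<noteq> y \<longrightarrow> P x y"
proof (intro allI impI)
  fix x y :: nat assume "x < 4" "y < 4" "x \<noteq> y"
  then have "x \<in> {i, j, k, l}" "y \<in> {i, j, k, l}" using assms(2) by auto
  then show "P x y" using assms(4-9) assms(4-9)[THEN sym] \<open>x \<noteq> y\<close> by auto
qed

lemma pair_in_four:
  fixes k l :: nat
  assumes "k < 4" "l < 4" "k \<noteq> l"
  obtains i j where "distinct [i, j, k, l]" "{i, j, k, l} = {..<4}"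
proof -
  have "card ({..<4} - {k, l}) = 2" using assms by (simp add: card_Diff_subset)
  then obtain i j where ij: "{..<4} - {k, l} = {i, j}" "i \<noteq> j" by (auto simp: card_2_iff)
  then have "{i, j, k, l} = {..<4}" using assms by auto
  moreover have "distinct [i, j, k, l]" using ij assms by auto
  ultimately show thesis using that by blast
qed

text \<open>The choice at the prime 2. Here \<open>S i j\<close> says that the pair is already taken care of by an odd prime, and \<open>F\<close> joins
the pairs that can be separated inside a residue class modulo 2. If \<open>F\<close> has a perfect matching, its two
edges go into the two classes modulo 2. Otherwise, as no three vertices are
independent, \<open>F\<close> is a triangle with an isolated vertex; the triangle fits in one class modulo 2 once
one of its edges can be separated modulo 8 inside a class modulo 4.\<close>

lemma two_adic_separation:
  fixes d :: "nat \<Rightarrow> nat \<Rightarrow> nat" and S :: "nat \<Rightarrow> nat \<Rightarrow> bool"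
  defines "F \<equiv> \<lambda>i j. S i j \<or> 4 dvd d i j"
  assumes dsym: "\<And>i j. d i j = d j i" and Ssym: "\<And>i j. S i j = S j i"
    and even: "\<And>i j. i < 4 \<Longrightarrow> j < 4 \<Longrightarrow> i \<noteq> j \<Longrightarrow> \<not> S i j \<Longrightarrow> 2 dvd d i j"
    and triple: "\<And>i j k. i < 4 \<Longrightarrow> j < 4 \<Longrightarrow> k < 4 \<Longrightarrow> distinct [i, j, k] \<Longrightarrow> F i j \<or> F j k \<or> F i k"
    and quadruple: "\<And>i j k l. distinct [i, j, k, l] \<Longrightarrow> {i, j, k, l} = {..<4} \<Longrightarrow>
      \<not> F i l \<Longrightarrow> \<not> F j l \<Longrightarrow> \<not> F k l \<Longrightarrow>
      \<exists>x\<in>{i, j, k}. \<exists>y\<in>{i, j, k}. x \<noteq> y \<and> (S x y \<or> 8 dvd d x y)"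
  shows "\<exists>u :: nat \<Rightarrow> int. \<forall>i<4. \<forall>j<4. i \<noteq> j \<longrightarrow> S i j \<or>
    (\<exists>e::nat. e dvd 8 \<and> e dvd d i j \<and> \<not> int e dvd u i - u j)"
    (is "\<exists>u. \<forall>i<4. \<forall>j<4. i \<noteq> j \<longrightarrow> ?P u i j")
proof -
  have Psym: "?P u j i" if "?P u i j" for u i j
    using that by (metis Ssym dsym dvd_minus_iff minus_diff_eq)
  have P2: "?P u i j" if "i < 4" "j < 4" "i \<noteq> j" "\<not> 2 dvd u i - u j" for u i j
  proof (cases "S i j")
    case False
    then have "2 dvd d i j" using even that by blast
    moreover have "\<not> int 2 dvd u i - u j" "(2::nat) dvd 8" using that by simp_all
    ultimately show ?thesis by blast
  qed simp
  have P4: "?P u i j" if "F i j" "\<not> 4 dvd u i - u j" for u i j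
  proof (cases "S i j")
    case False
    then have "4 dvd d i j" using that F_def by blast
    moreover have "\<not> int 4 dvd u i - u j" "(4::nat) dvd 8" using that by simp_all
    ultimately show ?thesis by blast
  qed simp
  have P8: "?P u i j" if "S i j \<or> 8 dvd d i j" "\<not> 8 dvd u i - u j" for u i j
  proof (cases "S i j")
    case False
    then have "8 dvd d i j" using that by blast
    moreover have "\<not> int 8 dvd u i - u j" "(8::nat) dvd 8" using that by simp_all
    ultimately show ?thesis by blast
  qed simp
  have Fsym: "F i j = F j i" for i j by (simp add: F_def dsym Ssym)
  have matching: "\<exists>u. \<forall>i<4. \<forall>j<4. i \<noteq> j \<longrightarrow> ?P u i j"
    if ijkl: "distinct [i, j, k, l]" "{i, j, k, l} = {..<4::nat}" and "F i j" "F k l" for i j k l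
  proof -
    define u where "u = (\<lambda>_. 0 :: int)(j := 2, k := 1, l := 3)"
    have u: "u i = 0" "u j = 2" "u k = 1" "u l = 3" using ijkl(1) by (auto simp: u_def)
    have lt: "i < 4" "j < 4" "k < 4" "l < 4" using ijkl(2) by auto
    have "\<forall>i<4. \<forall>j<4. i \<noteq> j \<longrightarrow> ?P u i j"
      by (rule labelling_of_four[OF ijkl]; (rule Psym, assumption)?)
         (rule P4 P2; use that u lt in \<open>simp; fail\<close>)+
    then show ?thesis by blast
  qed
  have triangle: "\<exists>u. \<forall>i<4. \<forall>j<4. i \<noteq> j \<longrightarrow> ?P u i j"
    if ijkl: "distinct [i, j, k, l]" "{i, j, k, l} = {..<4::nat}"
      and "S i j \<or> 8 dvd d i j" "F i k" "F j k" for i j k l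
  proof -
    define u where "u = (\<lambda>_. 0 :: int)(j := 4, k := 2, l := 1)"
    have u: "u i = 0" "u j = 4" "u k = 2" "u l = 1" using ijkl(1) by (auto simp: u_def)
    have lt: "i < 4" "j < 4" "k < 4" "l < 4" using ijkl(2) by auto
    have "\<forall>i<4. \<forall>j<4. i \<noteq> j \<longrightarrow> ?P u i j"
      by (rule labelling_of_four[OF ijkl]; (rule Psym, assumption)?)
         (rule P8 P4 P2; use that u lt in \<open>simp; fail\<close>)+
    then show ?thesis by blast
  qed
  show ?thesis
  proof (cases "\<exists>i j k l. distinct [i, j, k, l] \<and> {i, j, k, l} = {..<4::nat} \<and> F i j \<and> F k l")
    case True
    then show ?thesis using matching by blast
  next
    case False
    have "\<exists>i j k l. distinct [i, j, k, l] \<and> {i, j, k, l} = {..<4::nat} \<and>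
      \<not> F i l \<and> \<not> F j l \<and> \<not> F k l \<and> F i j \<and> F i k \<and> F j k"
    proof -
      have m: "\<not> (F 0 1 \<and> F 2 3)" "\<not> (F 0 2 \<and> F 1 3)" "\<not> (F 0 3 \<and> F 1 2)"
      proof -
        have e: "{0, 1, 2, 3} = {..<4::nat}" "{0, 2, 1, 3} = {..<4::nat}" "{0, 3, 1, 2} = {..<4::nat}" by auto
        have dd: "distinct [0, 1, 2, 3::nat]" "distinct [0, 2, 1, 3::nat]" "distinct [0, 3, 1, 2::nat]" by auto
        show "\<not> (F 0 1 \<and> F 2 3)" "\<not> (F 0 2 \<and> F 1 3)" "\<not> (F 0 3 \<and> F 1 2)"
          using False e dd by blast+
      qed
      have t: "F 0 1 \<or> F 1 2 \<or> F 0 2" "F 0 1 \<or> F 1 3 \<or> F 0 3" "F 0 2 \<or> F 2 3 \<or> F 0 3" "F 1 2 \<or> F 2 3 \<or> F 1 3"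
        by (rule triple; simp)+
      have e: "{1, 2, 3, 0} = {..<4::nat}" "{0, 2, 3, 1} = {..<4::nat}" "{0, 1, 3, 2} = {..<4::nat}"
         "{0, 1, 2, 3} = {..<4::nat}" by auto
      have dd: "distinct [1, 2, 3, 0::nat]" "distinct [0, 2, 3, 1::nat]" "distinct [0, 1, 3, 2::nat]"
        "distinct [0, 1, 2, 3::nat]" by auto
      have s: "F 1 0 = F 0 1" "F 2 0 = F 0 2" "F 3 0 = F 0 3" "F 2 1 = F 1 2" "F 3 1 = F 1 3" "F 3 2 = F 2 3"
        by (rule Fsym)+
      have "(\<not> F 1 0 \<and> \<not> F 2 0 \<and> \<not> F 3 0 \<and> F 1 2 \<and> F 1 3 \<and> F 2 3) \<or>
        (\<not> F 0 1 \<and> \<not> F 2 1 \<and> \<not> F 3 1 \<and> F 0 2 \<and> F 0 3 \<and> F 2 3) \<or>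
        (\<not> F 0 2 \<and> \<not> F 1 2 \<and> \<not> F 3 2 \<and> F 0 1 \<and> F 0 3 \<and> F 1 3) \<or>
        (\<not> F 0 3 \<and> \<not> F 1 3 \<and> \<not> F 2 3 \<and> F 0 1 \<and> F 0 2 \<and> F 1 2)"
        using m t unfolding s by argo
      then show ?thesis using e dd by blast
    qed
    then obtain i j k l where ijkl: "distinct [i, j, k, l]" "{i, j, k, l} = {..<4::nat}"
      "\<not> F i l" "\<not> F j l" "\<not> F k l" and T: "F i j" "F i k" "F j k" by blast
    obtain x y where xy: "x \<in> {i, j, k}" "y \<in> {i, j, k}" "x \<noteq> y" "S x y \<or> 8 dvd d x y"
      using quadruple[OF ijkl] by blast
    have G: "S x y \<or> 8 dvd d x y \<longleftrightarrow> S y x \<or> 8 dvd d y x" for x y using Ssym dsym by simp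
    consider "S i j \<or> 8 dvd d i j" | "S i k \<or> 8 dvd d i k" | "S j k \<or> 8 dvd d j k"
      using xy G by (elim insertE emptyE) metis+
    then show ?thesis
    proof cases
      case 1
      then show ?thesis using triangle[of i j k l] ijkl T by blast
    next
      case 2
      moreover have "distinct [i, k, j, l]" "{i, k, j, l} = {..<4}" using ijkl by auto
      ultimately show ?thesis using triangle[of i k j l] T Fsym by blast
    next
      case 3
      moreover have "distinct [j, k, i, l]" "{j, k, i, l} = {..<4}" using ijkl by auto
      ultimately show ?thesis using triangle[of j k i l] T Fsym by blast
    qed
  qed
qed

lemma prime_2_3_or_large:
  fixes p :: nat
  assumes "prime p"
  shows "p = 2 \<or> p = 3 \<or> 5 \<le> p"
proof -
  have "p \<noteq> 4"
  proof
    assume "p = 4"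
    then have "prime (2 * 2 :: nat)" using assms by simp
    then show False by (simp add: prime_product)
  qed
  then show ?thesis using prime_ge_2_nat[OF assms] by linarith
qed

text \<open>Modulo a prime above 3 the residues 0, 1, 2, 3 separate all pairs at once. The prime 3 also separates every pair of entries that
it divides, unless it divides all four entries and no gcd is divisible by 9; in this exceptional case one pair of
one's choice can be left to another prime, and some pair has another prime because not all gcds are 3. Outside the exceptional
case only the prime 2 leaves something to choose.\<close>

lemma separating_residues:
  fixes a :: "nat \<Rightarrow> nat"
  assumes pos: "\<And>i. i < 4 \<Longrightarrow> 0 < a i"
    and no_222: "\<And>i j k. \<lbrakk>i < 4; j < 4; k < 4; distinct [i, j, k]; gcd (a i) (a j) = 2;
      gcd (a j) (a k) = 2; gcd (a i) (a k) = 2\<rbrakk> \<Longrightarrow> False"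
    and no_3: "\<exists>i<4. \<exists>j<4. i \<noteq> j \<and> gcd (a i) (a j) \<noteq> 3"
    and no_42: "\<And>i j k l. \<lbrakk>distinct [i, j, k, l]; {i, j, k, l} = {..<4};
      gcd (a i) (a j) = 4; gcd (a i) (a k) = 4; gcd (a j) (a k) = 4;
      gcd (a i) (a l) = 2; gcd (a j) (a l) = 2; gcd (a k) (a l) = 2\<rbrakk> \<Longrightarrow> False"
  shows "\<exists>m :: nat \<Rightarrow> int. \<forall>i<4. \<forall>j<4. i \<noteq> j \<longrightarrow> gcd (a i) (a j) \<noteq> 1 \<longrightarrow>
    \<not> int (gcd (a i) (a j)) dvd m i - m j"
proof -
  define d where "d i j = gcd (a i) (a j)" for i j
  define N where "N = a 0 + a 1 + a 2 + a 3"
  have dsym: "d i j = d j i" for i j by (simp add: d_def gcd.commute)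
  have dle: "p \<le> N" if "p dvd d i j" "i < 4" for p i j
  proof -
    have "p dvd a i" using that(1) by (simp add: d_def)
    then have "p \<le> a i" using pos[OF that(2)] by (rule dvd_imp_le)
    moreover have "i = 0 \<or> i = 1 \<or> i = 2 \<or> i = 3" using that(2) by linarith
    ultimately show ?thesis by (auto simp: N_def)
  qed
  (* Distinct indices below 4 stay distinct modulo any prime above 3. *)
  have large: "\<not> int (d i j) dvd m i - m j"
    if m: "\<And>i p. prime p \<Longrightarrow> 5 \<le> p \<Longrightarrow> p \<le> N \<Longrightarrow> [m i = int i] (mod int p)"
      and p: "prime p" "5 \<le> p" "p dvd d i j" and ij: "i < 4" "j < 4" "i \<noteq> j" for m p i j
  proof
    assume "int (d i j) dvd m i - m j"
    moreover have "int p dvd int (d i j)" using p(3) by simp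
    ultimately have "int p dvd m i - m j" by (rule dvd_trans[rotated])
    then have "[m i = m j] (mod int p)" by (simp add: cong_iff_dvd_diff)
    moreover have "[m i = int i] (mod int p)" "[m j = int j] (mod int p)"
      using m p dle[OF p(3) ij(1)] by blast+
    ultimately have "[int i = int j] (mod int p)" by (meson cong_trans cong_sym)
    then have "int i = int j" using ij p(2) by (simp add: cong_def)
    then show False using ij by simp
  qed
  have cong_dvd: "\<not> int (d i j) dvd m i - m j"
    if "e dvd d i j" "e dvd M" "\<And>i. [m i = u i] (mod int M)" "\<not> int e dvd u i - u j"
    for m u :: "nat \<Rightarrow> int" and e M i j
  proof
    assume "int (d i j) dvd m i - m j"
    moreover have "int e dvd int (d i j)" using that(1) by simp
    ultimately have "int e dvd m i - m j" by (rule dvd_trans[rotated])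
    moreover have "[m i = u i] (mod int e)" "[m j = u j] (mod int e)"
      using that(2,3) by (meson cong_dvd_modulus of_nat_dvd_iff)+
    then have "[m i - m j = u i - u j] (mod int e)" by (rule cong_diff)
    ultimately have "int e dvd u i - u j" using cong_dvd_iff by blast
    then show False using that(4) by blast
  qed
  show ?thesis
  proof (cases "(\<forall>i<4. 3 dvd a i) \<and> (\<forall>i<4. \<forall>j<4. i \<noteq> j \<longrightarrow> \<not> 9 dvd d i j)")
    case True
    obtain k l where kl: "k < 4" "l < 4" "k \<noteq> l" "d k l \<noteq> 3" using no_3 by (auto simp: d_def)
    obtain i j where ij: "distinct [i, j, k, l]" "{i, j, k, l} = {..<4}"
      using pair_in_four[OF kl(1-3)] by blast
    have lt: "i < 4" "j < 4" using ij(2) by auto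
    have three: "3 dvd d x y" if "x < 4" "y < 4" for x y using True that by (simp add: d_def)
    obtain e where e: "d k l = 3 * e" using three kl by blast
    have "e \<noteq> 1" using e kl by simp
    then obtain p where p: "prime p" "p dvd e" using prime_factor_nat by blast
    (* The pair k, l is left unseparated modulo 3, and p takes care of it. *)
    have "p \<noteq> 3"
    proof
      assume "p = 3"
      then have "3 * 3 dvd d k l" using p e by (metis mult_dvd_mono dvd_refl)
      then show False using True kl by simp
    qed
    then have p_cases: "p = 2 \<or> 5 \<le> p" using prime_2_3_or_large[OF p(1)] by blast
    have pd: "p dvd d k l" using p e by simp
    define u v :: "nat \<Rightarrow> int" where "u = (\<lambda>_. 0)(l := 1)" and "v = (\<lambda>_. 0)(i := 1, j := 2)"
    obtain m where m: "\<And>i. [m i = u i] (mod 8)" "\<And>i. [m i = v i] (mod 9)"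
      "\<And>i p. prime p \<Longrightarrow> 5 \<le> p \<Longrightarrow> p \<le> N \<Longrightarrow> [m i = int i] (mod int p)"
      using residues_mod_8_9_and_large_primes[of u v N int] by blast
    have uv: "v i = 1" "v j = 2" "v k = 0" "v l = 0" "u k = 0" "u l = 1" using ij(1) by (auto simp: u_def v_def)
    have by3: "\<not> int (d x y) dvd m x - m y" if "x < 4" "y < 4" "\<not> 3 dvd v x - v y" for x y
      using cong_dvd[of 3 x y 9 m v] three[OF that(1,2)] m(2) that(3) by simp
    have "\<not> int (d k l) dvd m k - m l"
      using p_cases
    proof
      assume "p = 2"
      then show ?thesis using cong_dvd[of 2 k l 8 m u] pd m(1) uv by simp
    next
      assume "5 \<le> p"
      then show ?thesis using large[OF m(3) p(1) _ pd kl(1-3)] by blast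
    qed
    then have "\<forall>x<4. \<forall>y<4. x \<noteq> y \<longrightarrow> \<not> int (d x y) dvd m x - m y"
    proof (intro labelling_of_four[OF ij])
      show "\<not> int (d y x) dvd m y - m x" if "\<not> int (d x y) dvd m x - m y" for x y
        using that by (metis dsym dvd_diff_commute)
    qed ((rule by3; simp add: lt kl uv; fail) | fact)+
    then show ?thesis unfolding d_def by blast
  next
    case False
    obtain v :: "nat \<Rightarrow> int" where v: "\<And>x y. \<lbrakk>x < 4; y < 4; x \<noteq> y; 3 dvd d x y\<rbrakk> \<Longrightarrow>
      \<not> 3 dvd v x - v y \<or> (9 dvd d x y \<and> \<not> 9 dvd v x - v y)"
    proof (cases "\<exists>k<4. \<exists>l<4. k \<noteq> l \<and> 9 dvd d k l")
      case True
      then obtain k l where kl: "k < 4" "l < 4" "k \<noteq> l" "9 dvd d k l" by blast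
      obtain i j where ij: "distinct [i, j, k, l]" "{i, j, k, l} = {..<4}"
        using pair_in_four[OF kl(1-3)] by blast
      (* The pair k, l shares a class modulo 3 and differs modulo 9. *)
      define v :: "nat \<Rightarrow> int" where "v = (\<lambda>_. 0)(i := 1, j := 2, l := 3)"
      have vv: "v i = 1" "v j = 2" "v k = 0" "v l = 3" using ij(1) by (auto simp: v_def)
      have "\<forall>x<4. \<forall>y<4. x \<noteq> y \<longrightarrow> \<not> 3 dvd v x - v y \<or> (9 dvd d x y \<and> \<not> 9 dvd v x - v y)"
      proof (intro labelling_of_four[OF ij])
        show "\<not> 3 dvd v y - v x \<or> (9 dvd d y x \<and> \<not> 9 dvd v y - v x)"
          if "\<not> 3 dvd v x - v y \<or> (9 dvd d x y \<and> \<not> 9 dvd v x - v y)" for x y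
          using that by (metis dsym dvd_diff_commute)
      qed (use kl in \<open>simp_all add: vv\<close>)
      then show thesis using that[of v] by blast
    next
      case False
      then obtain i where i: "i < 4" "\<not> 3 dvd a i" using \<open>\<not> (_ \<and> _)\<close> by blast
      (* Skipping i numbers the other three indices 0, 1, 2. *)
      define v :: "nat \<Rightarrow> int" where "v x = (if i < x then int x - 1 else int x)" for x
      have "\<not> 3 dvd v x - v y" if "x < 4" "y < 4" "x \<noteq> y" "3 dvd d x y" for x y
      proof -
        have "x \<noteq> i" "y \<noteq> i" using that i by (auto simp: d_def)
        then have "v x \<noteq> v y" "\<bar>v x - v y\<bar> < 3" using that i unfolding v_def by (auto split: if_splits)
        then show ?thesis using zdvd_imp_le[of 3 "\<bar>v x - v y\<bar>"] by auto
      qed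
      then show thesis using that[of v] by blast
    qed
    (* Coprime pairs impose no condition and count as separated. *)
    define S where "S x y \<longleftrightarrow> d x y = 1 \<or> (\<exists>p. prime p \<and> p \<noteq> 2 \<and> p dvd d x y)" for x y
    have Ssym: "S x y = S y x" for x y by (simp add: S_def dsym)
    have nS: "d x y = 2 \<or> d x y = 4 \<or> 8 dvd d x y" if "\<not> S x y" "x < 4" for x y
    proof -
      have one: "\<exists>f. e = 2 * f" if "e dvd d x y" "e \<noteq> 1" for e
      proof -
        obtain p where p: "prime p" "p dvd e" using prime_factor_nat \<open>e \<noteq> 1\<close> by blast
        then have "p = 2" using \<open>\<not> S x y\<close> \<open>e dvd d x y\<close> dvd_trans unfolding S_def by blast
        then show ?thesis using p(2) by blast
      qed
      have "d x y \<noteq> 1" using that(1) by (simp add: S_def)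
      then obtain f where f: "d x y = 2 * f" using one[OF dvd_refl] by blast
      show ?thesis
      proof (cases "f = 1")
        case False
        then obtain g where g: "f = 2 * g" using one[of f] f by auto
        then show ?thesis
        proof (cases "g = 1")
          case False
          then obtain h where "g = 2 * h" using one[of g] f g by auto
          then show ?thesis using f g by simp
        qed (use f g in simp)
      qed (use f in simp)
    qed
    have "\<exists>u :: nat \<Rightarrow> int. \<forall>i<4. \<forall>j<4. i \<noteq> j \<longrightarrow> S i j \<or>
      (\<exists>e::nat. e dvd 8 \<and> e dvd d i j \<and> \<not> int e dvd u i - u j)"
    proof (rule two_adic_separation)
      show "2 dvd d i j" if "i < 4" "\<not> S i j" for i j using nS[OF that(2,1)] by auto
      have two: "d i j = 2" if "i < 4" "\<not> (S i j \<or> 4 dvd d i j)" for i j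
      proof -
        have "4 dvd (8::nat)" by simp
        then show ?thesis using nS[of i j] that by (metis dvd_refl dvd_trans)
      qed
      show "(S i j \<or> 4 dvd d i j) \<or> (S j k \<or> 4 dvd d j k) \<or> (S i k \<or> 4 dvd d i k)"
        if "i < 4" "j < 4" "k < 4" "distinct [i, j, k]" for i j k
        using no_222[OF that] two[of i j] two[of j k] two[of i k] that unfolding d_def by blast
      show "\<exists>x\<in>{i, j, k}. \<exists>y\<in>{i, j, k}. x \<noteq> y \<and> (S x y \<or> 8 dvd d x y)"
        if ijkl: "distinct [i, j, k, l]" "{i, j, k, l} = {..<4}"
          and n: "\<not> (S i l \<or> 4 dvd d i l)" "\<not> (S j l \<or> 4 dvd d j l)" "\<not> (S k l \<or> 4 dvd d k l)" for i j k l
      proof (rule ccontr)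
        assume not: "\<not> ?thesis"
        have lt: "i < 4" "j < 4" "k < 4" "l < 4" using ijkl(2) by auto
        have l2: "d i l = 2" "d j l = 2" "d k l = 2" using two n lt by blast+
        have c: "d x y = 4" if "x \<in> {i, j, k}" "y \<in> {i, j, k}" "x \<noteq> y" for x y
        proof -
          have xy: "\<not> S x y" "\<not> 8 dvd d x y" "x < 4" "y < 4" using not that lt by auto
          have "d x y \<noteq> 2"
          proof
            assume "d x y = 2"
            moreover have "distinct [x, y, l]" using that ijkl(1) by auto
            moreover have "d x l = 2" "d y l = 2" using that l2 by auto
            ultimately show False using no_222[of x y l] xy lt by (simp add: d_def)
          qed
          then show ?thesis using nS xy by blast
        qed
        have "d i j = 4" "d i k = 4" "d j k = 4" using c ijkl(1) by auto
        then show False using no_42[OF ijkl] l2 by (simp add: d_def)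
      qed
    qed (fact dsym Ssym)+
    then obtain u :: "nat \<Rightarrow> int" where u: "\<And>i j. i < 4 \<Longrightarrow> j < 4 \<Longrightarrow> i \<noteq> j \<Longrightarrow> \<not> S i j \<Longrightarrow>
      (\<exists>e::nat. e dvd 8 \<and> e dvd d i j \<and> \<not> int e dvd u i - u j)" by blast
    obtain m where m: "\<And>i. [m i = u i] (mod 8)" "\<And>i. [m i = v i] (mod 9)"
      "\<And>i p. prime p \<Longrightarrow> 5 \<le> p \<Longrightarrow> p \<le> N \<Longrightarrow> [m i = int i] (mod int p)"
      using residues_mod_8_9_and_large_primes[of u v N int] by blast
    have "\<not> int (d x y) dvd m x - m y" if xy: "x < 4" "y < 4" "x \<noteq> y" "d x y \<noteq> 1" for x y
    proof (cases "S x y")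
      case True
      then obtain p where p: "prime p" "p \<noteq> 2" "p dvd d x y" using xy(4) by (auto simp: S_def)
      show ?thesis
      proof (cases "p = 3")
        case True
        then have "\<not> 3 dvd v x - v y \<or> (9 dvd d x y \<and> \<not> 9 dvd v x - v y)" using v xy p by blast
        then show ?thesis
          using cong_dvd[of 3 x y 9 m v] cong_dvd[of 9 x y 9 m v] p True m(2) by auto
      next
        case False
        then have "5 \<le> p" using prime_2_3_or_large[OF p(1)] p(2) by blast
        then show ?thesis using large[OF m(3) p(1) _ p(3) xy(1-3)] by blast
      qed
    next
      case False
      then obtain e :: nat where "e dvd 8" "e dvd d x y" "\<not> int e dvd u x - u y" using u xy by blast
      then show ?thesis using cong_dvd[of e x y 8 m u] m(1) by simp
    qed
    then show ?thesis unfolding d_def by blast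
  qed
qed

section \<open>Invariant sets of tuples in a family of transitive actions\<close>

text \<open>The maps in \<open>\<Phi>\<close> stand for the translations by group elements. They live on one type for all indices, which
lets a single relation \<open>I\<close> compare elements at different indices.\<close>

locale transitive_family =
  fixes \<Phi> :: "('x \<Rightarrow> 'x) set" and \<Omega> :: "nat \<Rightarrow> 'x set" and I :: "'x \<Rightarrow> 'x \<Rightarrow> bool"
  assumes fin: "finite (\<Omega> i)"
    and maps: "\<phi> \<in> \<Phi> \<Longrightarrow> x \<in> \<Omega> i \<Longrightarrow> \<phi> x \<in> \<Omega> i"
    and inj: "\<phi> \<in> \<Phi> \<Longrightarrow> inj_on \<phi> (\<Omega> i)"
    and trans: "x \<in> \<Omega> i \<Longrightarrow> y \<in> \<Omega> i \<Longrightarrow> \<exists>\<phi>\<in>\<Phi>. \<phi> x = y"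
    and I_inv: "\<phi> \<in> \<Phi> \<Longrightarrow> x \<in> \<Omega> i \<Longrightarrow> y \<in> \<Omega> j \<Longrightarrow> I (\<phi> x) (\<phi> y) = I x y"
    and I_sym: "I x y = I y x"
begin

definition tuples :: "nat set \<Rightarrow> ((nat \<Rightarrow> 'x) \<Rightarrow> bool) \<Rightarrow> (nat \<Rightarrow> 'x) set" where
  "tuples J P = {t \<in> PiE J \<Omega>. P t}"

definition invariant :: "nat set \<Rightarrow> ((nat \<Rightarrow> 'x) \<Rightarrow> bool) \<Rightarrow> bool" where
  "invariant J P \<longleftrightarrow> (\<forall>\<phi>\<in>\<Phi>. \<forall>t\<in>PiE J \<Omega>. P (restrict (\<phi> \<circ> t) J) = P t)"

lemma invariant_I:
  assumes "i \<in> J" "j \<in> J"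
  shows "invariant J (\<lambda>t. I (t i) (t j) = b)"
  unfolding invariant_def
proof (intro ballI)
  fix \<phi> t assume "\<phi> \<in> \<Phi>" "t \<in> PiE J \<Omega>"
  then have "I (\<phi> (t i)) (\<phi> (t j)) = I (t i) (t j)"
    using I_inv[of \<phi> "t i" i "t j" j] PiE_mem assms by metis
  then show "(I (restrict (\<phi> \<circ> t) J i) (restrict (\<phi> \<circ> t) J j) = b) = (I (t i) (t j) = b)"
    using assms by simp
qed

lemma invariant_conj:
  assumes "invariant J P" "invariant J Q"
  shows "invariant J (\<lambda>t. P t \<and> Q t)"
  using assms by (simp add: invariant_def)

lemma image_Omega: "\<phi> \<in> \<Phi> \<Longrightarrow> \<phi> ` \<Omega> i = \<Omega> i"
  using maps inj by (intro endo_inj_surj[OF fin]) auto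

lemma card_invariant:
  assumes "\<phi> \<in> \<Phi>" "\<And>y. y \<in> \<Omega> j \<Longrightarrow> Q' (\<phi> y) = Q y"
  shows "card {y \<in> \<Omega> j. Q' y} = card {y \<in> \<Omega> j. Q y}"
proof -
  have "{y \<in> \<Omega> j. Q' y} = \<phi> ` {y \<in> \<Omega> j. Q y}"
  proof
    show "{y \<in> \<Omega> j. Q' y} \<subseteq> \<phi> ` {y \<in> \<Omega> j. Q y}"
    proof
      fix z assume z: "z \<in> {y \<in> \<Omega> j. Q' y}"
      then have "z \<in> \<phi> ` \<Omega> j" using image_Omega[OF assms(1)] by simp
      then obtain y where "y \<in> \<Omega> j" "z = \<phi> y" by (rule imageE)
      then show "z \<in> \<phi> ` {y \<in> \<Omega> j. Q y}" using z assms(2) by simp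
    qed
  qed (use assms(2) maps[OF assms(1)] in auto)
  moreover have "inj_on \<phi> {y \<in> \<Omega> j. Q y}"
    using inj[OF assms(1)] by (rule inj_on_subset) auto
  ultimately show ?thesis by (simp add: card_image)
qed

lemma finite_tuples: "finite J \<Longrightarrow> finite (tuples J P)"
  unfolding tuples_def by (simp add: fin finite_PiE)

text \<open>By transitivity, the fibres of the projection to the \<open>i\<close>-th coordinate all have the same size.\<close>

lemma card_dvd_card_tuples:
  assumes "finite J" "i \<in> J" "invariant J P"
  shows "card (\<Omega> i) dvd card (tuples J P)"
proof -
  let ?T = "\<lambda>x. {t \<in> tuples J P. t i = x}"
  have le: "card (?T x) \<le> card (?T y)" if xy: "x \<in> \<Omega> i" "y \<in> \<Omega> i" for x y
  proof -
    obtain \<phi> where \<phi>: "\<phi> \<in> \<Phi>" "\<phi> x = y" using trans[OF xy] by blast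
    let ?f = "\<lambda>t. restrict (\<phi> \<circ> t) J"
    have "inj_on ?f (PiE J \<Omega>)"
    proof (rule inj_onI)
      fix s t assume s: "s \<in> PiE J \<Omega>" and t: "t \<in> PiE J \<Omega>" and eq: "?f s = ?f t"
      show "s = t"
      proof (rule PiE_ext[OF s t])
        fix j assume j: "j \<in> J"
        have "\<phi> (s j) = \<phi> (t j)" using fun_cong[OF eq, of j] j by simp
        then show "s j = t j"
          using inj_onD[OF inj[OF \<phi>(1), of j]] PiE_mem[OF s j] PiE_mem[OF t j] by blast
      qed
    qed
    then have "inj_on ?f (?T x)" by (rule inj_on_subset) (auto simp: tuples_def)
    moreover have "?f ` ?T x \<subseteq> ?T y"
    proof
      fix s assume "s \<in> ?f ` ?T x"
      then obtain t where t: "t \<in> PiE J \<Omega>" "P t" "t i = x" "s = ?f t" by (auto simp: tuples_def)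
      have "?f t \<in> PiE J \<Omega>" using maps[OF \<phi>(1)] PiE_mem[OF t(1)] by auto
      moreover have "P (?f t)" using assms(3) \<phi>(1) t(1,2) unfolding invariant_def by blast
      moreover have "?f t i = y" using assms(2) t(3) \<phi>(2) by simp
      ultimately show "s \<in> ?T y" using t(4) by (simp add: tuples_def)
    qed
    ultimately show ?thesis
      by (intro card_inj_on_le[of ?f]) (simp_all add: finite_tuples[OF assms(1)])
  qed
  have "tuples J P = (\<Union>x\<in>\<Omega> i. ?T x)" using assms(2) by (auto simp: tuples_def)
  also have "card \<dots> = (\<Sum>x\<in>\<Omega> i. card (?T x))"
    using finite_tuples[OF assms(1)] by (intro card_UN_disjoint fin) auto
  finally have sum: "card (tuples J P) = (\<Sum>x\<in>\<Omega> i. card (?T x))" .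
  show ?thesis
  proof (cases "\<Omega> i = {}")
    case False
    then obtain y where y: "y \<in> \<Omega> i" by blast
    have "(\<Sum>x\<in>\<Omega> i. card (?T x)) = (\<Sum>x\<in>\<Omega> i. card (?T y))"
      using le y by (intro sum.cong order_antisym refl) auto
    then show ?thesis using sum by simp
  qed (use sum in simp)
qed

text \<open>Sets of tuples prescribed by relations along a tree are counted by attaching one leaf at a time.\<close>

lemma card_tuples_insert:
  assumes "finite J" "j \<notin> J"
    and deg: "\<And>t. t \<in> tuples J P \<Longrightarrow> card {y \<in> \<Omega> j. Q t y} = k"
    and R: "\<And>t y. t \<in> PiE J \<Omega> \<Longrightarrow> y \<in> \<Omega> j \<Longrightarrow> R (t(j := y)) \<longleftrightarrow> P t \<and> Q t y"
  shows "card (tuples (insert j J) R) = card (tuples J P) * k"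
proof -
  let ?S = "SIGMA t:tuples J P. {y \<in> \<Omega> j. Q t y}"
  let ?f = "\<lambda>(t, y). t(j := y)"
  have "tuples (insert j J) R = ?f ` ?S"
  proof
    show "?f ` ?S \<subseteq> tuples (insert j J) R"
    proof
      fix s assume "s \<in> ?f ` ?S"
      then obtain t y where ty: "t \<in> PiE J \<Omega>" "P t" "y \<in> \<Omega> j" "Q t y" "s = t(j := y)"
        by (auto simp: tuples_def)
      then have "s \<in> PiE (insert j J) \<Omega>" using PiE_fun_upd by metis
      then show "s \<in> tuples (insert j J) R" using R ty by (simp add: tuples_def)
    qed
  next
    show "tuples (insert j J) R \<subseteq> ?f ` ?S"
    proof
      fix s assume s: "s \<in> tuples (insert j J) R"
      then obtain y t where "y \<in> \<Omega> j" "t \<in> PiE J \<Omega>" "s = t(j := y)"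
        unfolding tuples_def PiE_insert_eq by auto
      moreover from this have "P t" "Q t y" using s R by (auto simp: tuples_def)
      ultimately show "s \<in> ?f ` ?S" by (force simp: tuples_def)
    qed
  qed
  moreover have "inj_on ?f ?S"
  proof (rule inj_onI, clarify)
    fix s y t z assume s: "s \<in> tuples J P" and t: "t \<in> tuples J P" and eq: "s(j := y) = t(j := z)"
    have "y = z" using fun_cong[OF eq, of j] by simp
    moreover have "s = t"
    proof (rule PiE_ext[of _ J \<Omega>])
      show "s \<in> PiE J \<Omega>" "t \<in> PiE J \<Omega>" using s t by (auto simp: tuples_def)
      show "s x = t x" if "x \<in> J" for x using fun_cong[OF eq, of x] assms(2) that by (auto split: if_splits)
    qed
    ultimately show "s = t \<and> y = z" by blast
  qed
  ultimately have "card (tuples (insert j J) R) = card ?S" by (simp add: card_image)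
  also have "\<dots> = (\<Sum>t\<in>tuples J P. card {y \<in> \<Omega> j. Q t y})"
    using finite_tuples[OF assms(1)] by (intro card_SigmaI) (auto simp: fin)
  also have "\<dots> = card (tuples J P) * k" using deg by simp
  finally show ?thesis .
qed

lemma card_tuples_single: "card (tuples {i} (\<lambda>_. True)) = card (\<Omega> i)"
  using card_PiE[of "{i}" \<Omega>] by (simp add: tuples_def)

text \<open>The elements of \<open>tuples J P\<close> with property \<open>Q\<close> form an invariant set again, so there are none of them or
at least as many as in \<open>tuples J P\<close>.\<close>

lemma single_orbit:
  assumes "finite J" and inv: "invariant J P" "invariant J Q"
    and dvd: "\<And>T. invariant J T \<Longrightarrow> card (tuples J P) dvd card (tuples J T)"
    and "s \<in> tuples J P" "t \<in> tuples J P"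
  shows "Q s = Q t"
proof -
  have main: "Q t" if st: "s \<in> tuples J P" "t \<in> tuples J P" "Q s" for s t
  proof -
    have sub: "tuples J (\<lambda>t. P t \<and> Q t) \<subseteq> tuples J P" by (auto simp: tuples_def)
    have "s \<in> tuples J (\<lambda>t. P t \<and> Q t)" using st by (simp add: tuples_def)
    then have "0 < card (tuples J (\<lambda>t. P t \<and> Q t))" using finite_tuples[OF assms(1)] card_gt_0_iff by blast
    then have "card (tuples J P) \<le> card (tuples J (\<lambda>t. P t \<and> Q t))"
      using dvd[OF invariant_conj[OF inv]] by (rule dvd_imp_le[rotated])
    then have "tuples J (\<lambda>t. P t \<and> Q t) = tuples J P"
      using sub finite_tuples[OF assms(1)] card_seteq by blast
    then show ?thesis using st(2) by (auto simp: tuples_def)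
  qed
  then show ?thesis using assms(5,6) by blast
qed

text \<open>Double counting gives $g p \cdot k = g q \cdot l$ for the two degrees $k$, $l$ of an invariant relation, and
coprimality of $p$ and $q$ leaves only $k = \kappa q$ and $l = \kappa p$. So the densities of
invariant relations on this pair are the multiples $\kappa / g$ of $1 / g$.\<close>

lemma degrees:
  assumes "i \<noteq> j" and card: "card (\<Omega> i) = g * p" "card (\<Omega> j) = g * q" "coprime p q"
    and ne: "x\<^sub>0 \<in> \<Omega> i" "y\<^sub>0 \<in> \<Omega> j"
  obtains \<kappa> where "\<And>x b. x \<in> \<Omega> i \<Longrightarrow> card {y \<in> \<Omega> j. I x y = b} = \<kappa> b * q"
    "\<And>y b. y \<in> \<Omega> j \<Longrightarrow> card {x \<in> \<Omega> i. I x y = b} = \<kappa> b * p"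
    "\<kappa> True + \<kappa> False = g"
proof -
  have gpq: "0 < g" "0 < p" "0 < q"
  proof -
    have "0 < card (\<Omega> i)" "0 < card (\<Omega> j)" using ne fin card_gt_0_iff by blast+
    then show "0 < g" "0 < p" "0 < q" using card by simp_all
  qed
  define K where "K b = card {y \<in> \<Omega> j. I x\<^sub>0 y = b}" for b
  define L where "L b = card {x \<in> \<Omega> i. I x y\<^sub>0 = b}" for b
  have K: "card {y \<in> \<Omega> j. I x y = b} = K b" if x: "x \<in> \<Omega> i" for x b
  proof -
    obtain \<phi> where "\<phi> \<in> \<Phi>" "\<phi> x\<^sub>0 = x" using trans[OF ne(1) x] by blast
    then show ?thesis unfolding K_def using I_inv[OF _ ne(1)] by (intro card_invariant) auto
  qed
  have L: "card {x \<in> \<Omega> i. I x y = b} = L b" if y: "y \<in> \<Omega> j" for y b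
  proof -
    obtain \<phi> where "\<phi> \<in> \<Phi>" "\<phi> y\<^sub>0 = y" using trans[OF ne(2) y] by blast
    then show ?thesis unfolding L_def using I_inv[OF _ _ ne(2)] by (intro card_invariant) auto
  qed
  have KL: "p * K b = q * L b" for b
  proof -
    have "g * p * K b = (\<Sum>x\<in>\<Omega> i. card {y \<in> \<Omega> j. I x y = b})" using K card by simp
    also have "\<dots> = (\<Sum>y\<in>\<Omega> j. card {x \<in> \<Omega> i. I x y = b})"
      using fin by (intro sum_multicount_gen) auto
    also have "\<dots> = g * q * L b" using L card by simp
    finally show ?thesis using gpq by simp
  qed
  have "\<exists>c. K b = c * q \<and> L b = c * p" for b
  proof -
    have "q dvd p * K b" using KL by simp
    then have "q dvd K b" using card(3) by (simp add: coprime_commute coprime_dvd_mult_right_iff)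
    then obtain c where c: "K b = q * c" by blast
    then have "L b = p * c" using KL[of b] gpq by (simp add: mult.left_commute)
    then show ?thesis using c by (auto simp: mult.commute)
  qed
  then obtain \<kappa> where \<kappa>: "\<And>b. K b = \<kappa> b * q \<and> L b = \<kappa> b * p" by metis
  have "card (\<Omega> j) = card ({y \<in> \<Omega> j. I x\<^sub>0 y = True} \<union> {y \<in> \<Omega> j. I x\<^sub>0 y = False})"
    by (rule arg_cong[of _ _ card]) auto
  also have "\<dots> = K True + K False" unfolding K_def by (rule card_Un_disjoint) (auto simp: fin)
  finally have "g * q = (\<kappa> True + \<kappa> False) * q" using \<kappa> card by (simp add: add_mult_distrib)
  then have "\<kappa> True + \<kappa> False = g" using gpq by simp
  then show thesis using that[of \<kappa>] K L \<kappa> by simp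
qed

end

section \<open>Tight sets and the two configurations\<close>

lemma lcm_scaled:
  fixes g p q :: nat
  assumes "coprime p q"
  shows "lcm (g * q) (g * p) = g * p * q"
proof -
  have "lcm (g * q) (g * p) = g * lcm q p" by (simp add: lcm_mult_left)
  also have "lcm q p = q * p" using assms by (simp add: lcm_coprime coprime_commute)
  finally show ?thesis by (simp add: mult_ac)
qed

text \<open>Used to identify a neighbourhood by excluding two thirds of the possible elements.\<close>

lemma third_part:
  assumes "finite V" "card V = 3 * p" "A \<subseteq> V" "B \<subseteq> V" "C \<subseteq> V"
    and "card A = p" "card B = p" "card C = p"
    and "A \<inter> B = {}" "A \<inter> C = {}" "B \<inter> C = {}"
  shows "C = V - A - B"
proof (rule card_seteq)
  show "finite (V - A - B)" using assms by simp
  show "C \<subseteq> V - A - B" using assms by blast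
  have "finite A" "finite B" using assms by (meson finite_subset)+
  then have "card (A \<union> B) = 2 * p" using assms by (simp add: card_Un_disjoint)
  moreover have "V - A - B = V - (A \<union> B)" by blast
  ultimately have "card (V - A - B) = 3 * p - 2 * p"
    using assms \<open>finite A\<close> \<open>finite B\<close> by (simp add: card_Diff_subset)
  then show "card (V - A - B) \<le> card C" using assms by simp
qed

lemma nonempty_third_part:
  assumes "finite V" "card V = 3 * p" "0 < p" "card A = p" "card B = p"
  obtains v where "v \<in> V" "v \<notin> A" "v \<notin> B"
proof -
  have "finite A" "finite B" using assms card_ge_0_finite by metis+
  have "\<not> V \<subseteq> A \<union> B"
  proof
    assume "V \<subseteq> A \<union> B"
    then have "card V \<le> card (A \<union> B)" using \<open>finite A\<close> \<open>finite B\<close> by (intro card_mono) auto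
    also have "\<dots> \<le> p + p" using card_Un_le[of A B] assms by simp
    finally show False using assms by simp
  qed
  then show thesis using that by blast
qed

context transitive_family
begin

text \<open>A tight set is as small as divisibility allows a nonempty invariant set to be, so it is a single orbit as far as invariant
properties are concerned. The size \<open>L\<close> is a parameter so that it can be updated when a leaf is attached.\<close>

definition tight :: "nat set \<Rightarrow> ((nat \<Rightarrow> 'x) \<Rightarrow> bool) \<Rightarrow> nat \<Rightarrow> bool" where
  "tight J P L \<longleftrightarrow> finite J \<and> invariant J P \<and> card (tuples J P) = L \<and> (LCM i\<in>J. card (\<Omega> i)) = L"

lemma tight_single: "tight {i} (\<lambda>_. True) (card (\<Omega> i))"
  by (simp add: tight_def invariant_def card_tuples_single)

lemma LCM_dvd_card_tuples:
  assumes "finite J" "invariant J P"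
  shows "(LCM i\<in>J. card (\<Omega> i)) dvd card (tuples J P)"
  using card_dvd_card_tuples[OF assms(1) _ assms(2)] by (auto intro!: Lcm_least)

lemma tight_insert:
  assumes "tight J P L" "j \<notin> J"
    and "\<And>t. t \<in> tuples J P \<Longrightarrow> card {y \<in> \<Omega> j. Q t y} = k"
    and "\<And>t y. t \<in> PiE J \<Omega> \<Longrightarrow> y \<in> \<Omega> j \<Longrightarrow> R (t(j := y)) \<longleftrightarrow> P t \<and> Q t y"
    and "invariant (insert j J) R" "lcm (card (\<Omega> j)) L = L * k"
  shows "tight (insert j J) R (L * k)"
proof -
  have fin: "finite J" using assms(1) by (simp add: tight_def)
  have "card (tuples (insert j J) R) = card (tuples J P) * k"
    using assms(2-4) by (rule card_tuples_insert[OF fin])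
  then show ?thesis using assms by (simp add: tight_def)
qed

lemma tight_constant:
  assumes "tight J P L" "invariant J Q" "s \<in> tuples J P" "t \<in> tuples J P"
  shows "Q s = Q t"
proof (rule single_orbit)
  show "card (tuples J P) dvd card (tuples J T)" if "invariant J T" for T
    using LCM_dvd_card_tuples[OF _ that] assms(1) by (simp add: tight_def)
qed (use assms in \<open>simp_all add: tight_def\<close>)

end

text \<open>In the application, \<open>c True\<close> consists of the subgroups, any two of which meet, and \<open>c False\<close> of the disjoint
cosets. Indexing by truth values makes each statement about \<open>I\<close> available for the complement of \<open>I\<close> as well.\<close>

locale two_configurations = transitive_family \<Phi> \<Omega> I
  for \<Phi> :: "('x \<Rightarrow> 'x) set" and \<Omega> :: "nat \<Rightarrow> 'x set" and I :: "'x \<Rightarrow> 'x \<Rightarrow> bool" +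
  fixes n :: nat and c :: "bool \<Rightarrow> nat \<Rightarrow> 'x"
  assumes c_in: "i < n \<Longrightarrow> c b i \<in> \<Omega> i"
    and c_I: "i < n \<Longrightarrow> j < n \<Longrightarrow> i \<noteq> j \<Longrightarrow> I (c b i) (c b j) = b"
begin

lemma card_pos: "i < n \<Longrightarrow> 0 < card (\<Omega> i)"
  using c_in fin card_gt_0_iff by blast

text \<open>Neither \<open>I\<close> nor its complement is empty on the pair because of the two configurations. So both densities are
positive multiples of \<open>1/g\<close>, with sum 1.\<close>

lemma pair_degrees:
  assumes ij: "i < n" "j < n" "i \<noteq> j"
    and card: "card (\<Omega> i) = g * p" "card (\<Omega> j) = g * q" "coprime p q"
  obtains \<kappa> where "\<And>x b. x \<in> \<Omega> i \<Longrightarrow> card {y \<in> \<Omega> j. I x y = b} = \<kappa> b * q"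
    "\<And>y b. y \<in> \<Omega> j \<Longrightarrow> card {x \<in> \<Omega> i. I y x = b} = \<kappa> b * p"
    "\<kappa> True + \<kappa> False = g" "\<And>b. 0 < \<kappa> b"
proof -
  obtain \<kappa> where \<kappa>: "\<And>x b. x \<in> \<Omega> i \<Longrightarrow> card {y \<in> \<Omega> j. I x y = b} = \<kappa> b * q"
    "\<And>y b. y \<in> \<Omega> j \<Longrightarrow> card {x \<in> \<Omega> i. I x y = b} = \<kappa> b * p"
    "\<kappa> True + \<kappa> False = g"
    using degrees[OF ij(3) card c_in[OF ij(1)] c_in[OF ij(2)]] by blast
  have "0 < \<kappa> b" for b
  proof -
    have "c b j \<in> {y \<in> \<Omega> j. I (c b i) y = b}" using c_in c_I ij by simp
    moreover have "finite {y \<in> \<Omega> j. I (c b i) y = b}" using fin by simp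
    ultimately have "0 < card {y \<in> \<Omega> j. I (c b i) y = b}" using card_gt_0_iff by blast
    then show ?thesis using \<kappa>(1) c_in ij by simp
  qed
  then show thesis using that[of \<kappa>] \<kappa> I_sym by simp
qed

lemma not_coprime:
  assumes "i < n" "j < n" "i \<noteq> j"
  shows "gcd (card (\<Omega> i)) (card (\<Omega> j)) \<noteq> 1"
proof
  assume "gcd (card (\<Omega> i)) (card (\<Omega> j)) = 1"
  then have cop: "coprime (card (\<Omega> i)) (card (\<Omega> j))" by (simp add: coprime_iff_gcd_eq_1)
  obtain \<kappa> where "\<And>x b. x \<in> \<Omega> i \<Longrightarrow> card {y \<in> \<Omega> j. I x y = b} = \<kappa> b * card (\<Omega> j)"
    "\<And>y b. y \<in> \<Omega> j \<Longrightarrow> card {x \<in> \<Omega> i. I y x = b} = \<kappa> b * card (\<Omega> i)"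
    and \<kappa>: "\<kappa> True + \<kappa> False = 1" "\<And>b. 0 < \<kappa> b"
    using pair_degrees[OF assms _ _ cop, of 1] unfolding mult_1 by blast
  show False using \<kappa>(1) \<kappa>(2)[of True] \<kappa>(2)[of False] by linarith
qed

end

text \<open>Covers the triples with gcds 2 and the quadruples with gcds 3.\<close>

locale equal_gcds = two_configurations +
  fixes K :: "nat set" and g :: nat and p :: "nat \<Rightarrow> nat"
  assumes K: "i \<in> K \<Longrightarrow> i < n"
    and card_Omega: "i \<in> K \<Longrightarrow> card (\<Omega> i) = g * p i"
    and coprime_p: "i \<in> K \<Longrightarrow> j \<in> K \<Longrightarrow> i \<noteq> j \<Longrightarrow> coprime (p i) (p j)"
begin

lemma p_pos: "i \<in> K \<Longrightarrow> 0 < p i"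
  using card_pos[OF K] card_Omega by fastforce

text \<open>The relation with truth value \<open>b\<close> has the smallest positive density \<open>1/g\<close>, seen from \<open>\<Omega> i\<close>.\<close>

definition thin :: "bool \<Rightarrow> nat \<Rightarrow> nat \<Rightarrow> bool" where
  "thin b i j \<longleftrightarrow> (\<forall>x\<in>\<Omega> i. card {y \<in> \<Omega> j. I x y = b} = p j)"

lemma thin_pair: "i \<in> K \<Longrightarrow> j \<in> K \<Longrightarrow> i \<noteq> j \<Longrightarrow> thin b i j \<Longrightarrow>
    tight {j, i} (\<lambda>t. I (t i) (t j) = b) (g * p i * p j)"
  using tight_insert[OF tight_single[of i], of j "\<lambda>t y. I (t i) y = b" "p j" "\<lambda>t. I (t i) (t j) = b"]
  by (auto simp: thin_def card_Omega tuples_def lcm_scaled coprime_p intro!: invariant_I)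

text \<open>Attaching a leaf by a thin relation multiplies the number of tuples by \<open>p j\<close>, which is also the factor by
which the least common multiple grows.\<close>

lemma thin_insert:
  assumes "tight J P (g * q)" "i \<in> J" "i \<in> K" "j \<in> K" "j \<notin> J" "thin b i j" "coprime q (p j)"
    and "\<And>t y. P (t(j := y)) = P t" "invariant (insert j J) P"
  shows "tight (insert j J) (\<lambda>t. P t \<and> I (t i) (t j) = b) (g * (q * p j))"
proof -
  have "tight (insert j J) (\<lambda>t. P t \<and> I (t i) (t j) = b) (g * q * p j)"
  proof (rule tight_insert[where Q = "\<lambda>t y. I (t i) y = b"])
    show "card {y \<in> \<Omega> j. I (t i) y = b} = p j" if "t \<in> tuples J P" for t
      using that assms(2,6) unfolding thin_def tuples_def by blast
    show "invariant (insert j J) (\<lambda>t. P t \<and> I (t i) (t j) = b)"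
      using assms by (intro invariant_conj invariant_I) auto
    show "lcm (card (\<Omega> j)) (g * q) = g * q * p j"
      using assms by (simp add: card_Omega lcm_scaled)
  qed (use assms in auto)
  then show ?thesis by (simp add: mult.assoc)
qed

lemma thin_star:
  assumes ijk: "distinct [i, j, k]" "i \<in> K" "j \<in> K" "k \<in> K" and thin: "thin b i j" "thin b' i k"
    and x: "x \<in> \<Omega> i" "y \<in> \<Omega> j" "z \<in> \<Omega> k" "I x y = b" "I x z = b'"
    and x': "x' \<in> \<Omega> i" "y' \<in> \<Omega> j" "z' \<in> \<Omega> k" "I x' y' = b" "I x' z' = b'"
  shows "I y z = I y' z'"
proof -
  have "tight {j, i} (\<lambda>t. I (t i) (t j) = b) (g * (p i * p j))"
    using thin_pair[of i j b] ijk thin by (auto simp: mult.assoc)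
  then have T: "tight {k, j, i} (\<lambda>t. I (t i) (t j) = b \<and> I (t i) (t k) = b') (g * (p i * p j * p k))"
    using ijk thin by (intro thin_insert) (auto simp: coprime_p intro: invariant_I)
  define s where "s x y z = (\<lambda>_. undefined)(i := x, j := y, k := z)" for x y z :: 'a
  have s: "s x y z i = x" "s x y z j = y" "s x y z k = z" for x y z using ijk by (auto simp: s_def)
  have ext: "s x y z \<in> PiE {k, j, i} \<Omega>" if "x \<in> \<Omega> i" "y \<in> \<Omega> j" "z \<in> \<Omega> k" for x y z
    using that ijk by (auto simp: s_def PiE_def extensional_def)
  have "(I (s x y z j) (s x y z k) = True) = (I (s x' y' z' j) (s x' y' z' k) = True)"
  proof (rule tight_constant[OF T])
    show "invariant {k, j, i} (\<lambda>t. I (t j) (t k) = True)" by (rule invariant_I) auto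
  qed (use ext x x' in \<open>auto simp: tuples_def s\<close>)
  then show ?thesis by (simp add: s)
qed

lemma thin_path:
  assumes ijkl: "distinct [i, j, k, l]" "i \<in> K" "j \<in> K" "k \<in> K" "l \<in> K"
    and thin: "thin b1 i j" "thin b2 j k" "thin b3 k l"
    and x: "x \<in> \<Omega> i" "y \<in> \<Omega> j" "z \<in> \<Omega> k" "w \<in> \<Omega> l" "I x y = b1" "I y z = b2" "I z w = b3"
    and x': "x' \<in> \<Omega> i" "y' \<in> \<Omega> j" "z' \<in> \<Omega> k" "w' \<in> \<Omega> l" "I x' y' = b1" "I y' z' = b2" "I z' w' = b3"
  shows "I x w = I x' w'"
proof -
  have "tight {j, i} (\<lambda>t. I (t i) (t j) = b1) (g * (p i * p j))"
    using thin_pair[of i j b1] ijkl thin by (auto simp: mult.assoc)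
  then have "tight {k, j, i} (\<lambda>t. I (t i) (t j) = b1 \<and> I (t j) (t k) = b2) (g * (p i * p j * p k))"
    using ijkl thin by (intro thin_insert) (auto simp: coprime_p intro: invariant_I)
  from this have T: "tight {l, k, j, i} (\<lambda>t. (I (t i) (t j) = b1 \<and> I (t j) (t k) = b2) \<and> I (t k) (t l) = b3)
      (g * (p i * p j * p k * p l))"
    by (rule thin_insert) (use ijkl thin in \<open>auto simp: coprime_p intro!: invariant_I invariant_conj\<close>)
  define s where "s x y z w = (\<lambda>_. undefined)(i := x, j := y, k := z, l := w)" for x y z w :: 'a
  have s: "s x y z w i = x" "s x y z w j = y" "s x y z w k = z" "s x y z w l = w" for x y z w
    using ijkl by (auto simp: s_def)
  have ext: "s x y z w \<in> PiE {l, k, j, i} \<Omega>" if "x \<in> \<Omega> i" "y \<in> \<Omega> j" "z \<in> \<Omega> k" "w \<in> \<Omega> l" for x y z w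
    using that ijkl by (auto simp: s_def PiE_def extensional_def)
  have "(I (s x y z w i) (s x y z w l) = True) = (I (s x' y' z' w' i) (s x' y' z' w' l) = True)"
  proof (rule tight_constant[OF T])
    show "invariant {l, k, j, i} (\<lambda>t. I (t i) (t l) = True)" by (rule invariant_I) auto
  qed (use ext x x' in \<open>auto simp: tuples_def s\<close>)
  then show ?thesis by (simp add: s)
qed

lemma thin_of_two:
  assumes "g = 2" "i \<in> K" "j \<in> K" "i \<noteq> j"
  shows "thin b i j"
proof -
  obtain \<kappa> where \<kappa>: "\<And>x b. x \<in> \<Omega> i \<Longrightarrow> card {y \<in> \<Omega> j. I x y = b} = \<kappa> b * p j"
    "\<And>y b. y \<in> \<Omega> j \<Longrightarrow> card {x \<in> \<Omega> i. I y x = b} = \<kappa> b * p i"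
    "\<kappa> True + \<kappa> False = g" "\<And>b. 0 < \<kappa> b"
    using pair_degrees[OF K[OF assms(2)] K[OF assms(3)] assms(4) card_Omega[OF assms(2)]
      card_Omega[OF assms(3)] coprime_p[OF assms(2-4)]] by blast
  have "\<kappa> True = 1" "\<kappa> False = 1" using \<kappa>(3) \<kappa>(4)[of True] \<kappa>(4)[of False] assms(1) by linarith+
  then have "\<kappa> b = 1" by (cases b) auto
  then show ?thesis using \<kappa>(1) by (simp add: thin_def)
qed

text \<open>All relations are thin here, so tightness applies to \<open>I\<close> and to its complement. For related \<open>x\<close> and \<open>y\<close>, an element
\<open>z\<close> cannot be unrelated to both; as each of the two is related to exactly half of the elements, those unrelated to
\<open>x\<close> are precisely those related to \<open>y\<close>. But some \<open>z\<close> is related to both.\<close>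

lemma no_triple_of_gcd_two:
  assumes "g = 2" and ijk: "distinct [i, j, k]" "i \<in> K" "j \<in> K" "k \<in> K"
  shows False
proof -
  let ?x = "c True i" and ?y = "c True j"
  let ?A = "{z \<in> \<Omega> k. I ?x z = False}" and ?B = "{z \<in> \<Omega> k. I ?y z = True}"
  note lt = K[OF ijk(2)] K[OF ijk(3)] K[OF ijk(4)]
  note mem = c_in[OF lt(1)] c_in[OF lt(2)] c_in[OF lt(3)]
  have ne: "i \<noteq> j" "i \<noteq> k" "j \<noteq> k" using ijk(1) by auto
  have "?A \<subseteq> ?B"
  proof (rule ccontr)
    assume "\<not> ?A \<subseteq> ?B"
    then obtain z where z: "z \<in> \<Omega> k" "I z ?x = False" "I z ?y = False" using I_sym by blast
    have "I ?x ?y = I (c False i) (c False j)"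
    proof (rule thin_star[of k i j False False])
      show "I (c False k) (c False i) = False" "I (c False k) (c False j) = False"
        using c_I lt ne by auto
    qed (use ijk ne mem z thin_of_two[OF assms(1)] in auto)
    then show False using c_I lt ne by simp
  qed
  moreover have "card ?A = p k" "card ?B = p k"
    using thin_of_two[OF assms(1)] ijk ne mem unfolding thin_def by blast+
  ultimately have "?A = ?B" using fin by (intro card_seteq) auto
  moreover have "c True k \<in> ?B" using mem c_I lt ne by simp
  ultimately show False using c_I[OF lt(1,3) ne(2), of True] by blast
qed

end

section \<open>Six gcds equal to three\<close>

locale gcds_three = equal_gcds \<Phi> \<Omega> I n c K 3 p
  for \<Phi> :: "('x \<Rightarrow> 'x) set" and \<Omega> :: "nat \<Rightarrow> 'x set" and I :: "'x \<Rightarrow> 'x \<Rightarrow> bool"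
    and n :: nat and c :: "bool \<Rightarrow> nat \<Rightarrow> 'x" and K :: "nat set" and p :: "nat \<Rightarrow> nat"
begin

lemma c_mem: "i \<in> K \<Longrightarrow> c b i \<in> \<Omega> i"
  using c_in K by blast

lemma c_rel: "i \<in> K \<Longrightarrow> j \<in> K \<Longrightarrow> i \<noteq> j \<Longrightarrow> I (c b i) (c b j) = b"
  using c_I K by blast

lemma thin_cases: "i \<in> K \<Longrightarrow> j \<in> K \<Longrightarrow> i \<noteq> j \<Longrightarrow> \<exists>b. thin b i j \<and> thin b j i"
proof -
  assume ij: "i \<in> K" "j \<in> K" "i \<noteq> j"
  obtain \<kappa> where \<kappa>: "\<And>x b. x \<in> \<Omega> i \<Longrightarrow> card {y \<in> \<Omega> j. I x y = b} = \<kappa> b * p j"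
    "\<And>y b. y \<in> \<Omega> j \<Longrightarrow> card {x \<in> \<Omega> i. I y x = b} = \<kappa> b * p i"
    "\<kappa> True + \<kappa> False = 3" "\<And>b. 0 < \<kappa> b"
    using pair_degrees[OF K[OF ij(1)] K[OF ij(2)] ij(3) card_Omega[OF ij(1)] card_Omega[OF ij(2)]
      coprime_p[OF ij]] by blast
  have "\<kappa> True = 1 \<or> \<kappa> False = 1" using \<kappa>(3) \<kappa>(4)[of True] \<kappa>(4)[of False] by linarith
  then obtain b where "\<kappa> b = 1" by blast
  then show ?thesis using \<kappa>(1,2) by (auto simp: thin_def)
qed

text \<open>The colour of a pair tells whether \<open>I\<close> or its complement is thin on it. The two densities are one third and
two thirds, so one of them is thin in both directions.\<close>

definition colour :: "nat \<Rightarrow> nat \<Rightarrow> bool" where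
  "colour i j \<longleftrightarrow> thin True i j \<and> thin True j i"

lemma colour_sym: "colour i j = colour j i"
  by (auto simp: colour_def)

lemma thin_colour:
  assumes "i \<in> K" "j \<in> K" "i \<noteq> j"
  shows "thin (colour i j) i j"
proof (cases "colour i j")
  case False
  obtain b where b: "thin b i j" "thin b j i" using thin_cases[OF assms] by blast
  then have "b = False" using False by (cases b) (simp_all add: colour_def)
  then show ?thesis using b False by simp
qed (simp add: colour_def)

text \<open>Neighbours with respect to the thin relation of the pair, of density one third.\<close>

definition nbrs :: "nat \<Rightarrow> nat \<Rightarrow> 'x \<Rightarrow> 'x set" where
  "nbrs i j x = {y \<in> \<Omega> j. I x y = colour i j}"

lemma nbrs_subset: "nbrs i j x \<subseteq> \<Omega> j"
  by (auto simp: nbrs_def)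

lemma finite_nbrs: "finite (nbrs i j x)"
  using fin by (simp add: nbrs_def)

lemma card_nbrs: "i \<in> K \<Longrightarrow> j \<in> K \<Longrightarrow> i \<noteq> j \<Longrightarrow> x \<in> \<Omega> i \<Longrightarrow> card (nbrs i j x) = p j"
  using thin_colour by (simp add: nbrs_def thin_def)

lemma nbrs_nonempty: "i \<in> K \<Longrightarrow> j \<in> K \<Longrightarrow> i \<noteq> j \<Longrightarrow> x \<in> \<Omega> i \<Longrightarrow> \<exists>y. y \<in> nbrs i j x"
  using card_nbrs p_pos by (metis card.empty ex_in_conv less_numeral_extra(3))

lemma nbrs_sym: "x \<in> \<Omega> i \<Longrightarrow> y \<in> nbrs i j x \<Longrightarrow> x \<in> nbrs j i y"
  using colour_sym I_sym by (auto simp: nbrs_def)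

text \<open>Two thin relations of the same colour at a common vertex form a tight set, on which the configuration of that
colour determines the relation of the two ends.\<close>

lemma star_thin:
  assumes "distinct [i, j, k]" "i \<in> K" "j \<in> K" "k \<in> K" "colour i j = b" "colour i k = b"
    and "x \<in> \<Omega> i" "y \<in> nbrs i j x" "z \<in> nbrs i k x"
  shows "I y z = b"
proof -
  have "I y z = I (c b j) (c b k)"
    by (rule thin_star[of i j k b b x y z "c b i" "c b j" "c b k"])
       (use assms thin_colour[of i j] thin_colour[of i k] c_mem c_rel in \<open>auto simp: nbrs_def\<close>)
  then show ?thesis using assms c_rel by simp
qed

text \<open>In the configuration of the opposite colour, the neighbourhoods in \<open>\<Omega> l\<close> of the members at \<open>i\<close>, \<open>j\<close>, \<open>k\<close> are disjoint, for a
common neighbour would make two of these members related in colour \<open>b\<close>. So these three thirds cover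
\<open>\<Omega> l\<close>, and the member at \<open>l\<close> lies in one of them.\<close>

lemma no_monochromatic_star:
  assumes dist: "distinct [i, j, k, l]" and mem: "i \<in> K" "j \<in> K" "k \<in> K" "l \<in> K"
    and colour: "colour l i = b" "colour l j = b" "colour l k = b"
  shows False
proof -
  let ?c = "c (\<not> b)"
  have disj: "nbrs m l (?c m) \<inter> nbrs m' l (?c m') = {}"
    if m: "m \<in> {i, j, k}" "m' \<in> {i, j, k}" "m \<noteq> m'" for m m'
  proof (rule ccontr)
    assume "\<not> ?thesis"
    then obtain y where y: "y \<in> nbrs m l (?c m)" "y \<in> nbrs m' l (?c m')" by blast
    have mm: "m \<in> K" "m' \<in> K" "distinct [l, m, m']" using m mem dist by auto
    have "I (?c m) (?c m') = b"
    proof (rule star_thin[of l m m' b y])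
      show "colour l m = b" "colour l m' = b" using m colour by auto
      show "?c m \<in> nbrs l m y" "?c m' \<in> nbrs l m' y" using y nbrs_sym c_mem mm by blast+
      show "y \<in> \<Omega> l" using y nbrs_subset by blast
    qed (use mm mem in auto)
    then show False using c_rel[of m m' "\<not> b"] mm by simp
  qed
  have "nbrs i l (?c i) \<inter> nbrs j l (?c j) = {}" "nbrs i l (?c i) \<inter> nbrs k l (?c k) = {}"
    "nbrs j l (?c j) \<inter> nbrs k l (?c k) = {}"
    using dist by (intro disj; simp)+
  then have "nbrs k l (?c k) = \<Omega> l - nbrs i l (?c i) - nbrs j l (?c j)"
    by (intro third_part[of _ "p l"]) (use mem dist in \<open>simp_all add: fin card_Omega card_nbrs c_mem nbrs_subset\<close>)
  moreover have "?c l \<in> \<Omega> l" using c_mem mem by blast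
  ultimately have "?c l \<in> nbrs i l (?c i) \<or> ?c l \<in> nbrs j l (?c j) \<or> ?c l \<in> nbrs k l (?c k)" by blast
  then show False
    using c_rel[of i l "\<not> b"] c_rel[of j l "\<not> b"] c_rel[of k l "\<not> b"] mem dist colour colour_sym
    by (auto simp: nbrs_def)
qed

end

locale four_gcds_three = gcds_three +
  assumes card_K: "card K = 4"
begin

lemma fourth: "distinct [i, j, k] \<Longrightarrow> i \<in> K \<Longrightarrow> j \<in> K \<Longrightarrow> k \<in> K \<Longrightarrow> \<exists>l. l \<in> K \<and> distinct [i, j, k, l]"
proof -
  assume "distinct [i, j, k]" "i \<in> K" "j \<in> K" "k \<in> K"
  moreover have "\<not> K \<subseteq> {i, j, k}"
  proof
    assume "K \<subseteq> {i, j, k}"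
    then have "card K \<le> card {i, j, k}" by (intro card_mono) auto
    also have "\<dots> \<le> 3" by (simp add: card_insert_if)
    finally show False using card_K by simp
  qed
  ultimately show ?thesis by fastforce
qed

text \<open>No triangle of vertices is monochromatic: otherwise some vertex would be the centre of a monochromatic star. So two edges of the
triangle share a colour that the third does not have, and the star of these two edges forces the wrong relation
on the third.\<close>

lemma no_triangle:
  assumes ijk: "distinct [i, j, k]" "i \<in> K" "j \<in> K" "k \<in> K"
    and "x \<in> \<Omega> i" "y \<in> nbrs i j x" "z \<in> nbrs i k x" "z \<in> nbrs j k y"
  shows False
proof -
  obtain l where l: "l \<in> K" "distinct [i, j, k, l]" using fourth ijk by blast
  have star: "\<not> (colour d a = b \<and> colour d a' = b \<and> colour d a'' = b)"
    if "a \<in> K" "a' \<in> K" "a'' \<in> K" "d \<in> K" "distinct [a, a', a'', d]" for a a' a'' d b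
    using no_monochromatic_star that by blast
  have "\<not> (colour i j = colour i k \<and> colour i k = colour j k)"
    using star[of j k l i "colour i j"] star[of i k l j "colour i j"] star[of i j l k "colour i j"]
      star[of i j k l "\<not> colour i j"]
      ijk l by (auto simp: colour_sym)
  then consider "colour i j = colour i k" "colour j k \<noteq> colour i j"
    | "colour i j = colour j k" "colour i k \<noteq> colour i j"
    | "colour i k = colour j k" "colour i j \<noteq> colour i k"
    by (cases "colour i j"; cases "colour i k"; cases "colour j k") simp_all
  then show False
  proof cases
    case 1
    have "I y z = colour i j" by (rule star_thin[OF ijk refl 1(1)[symmetric] assms(5-7)])
    then show False using 1 assms by (simp add: nbrs_def)
  next
    case 2
    have jik: "distinct [j, i, k]" using ijk by auto
    have x: "x \<in> nbrs j i y" "y \<in> \<Omega> j" using assms nbrs_sym nbrs_subset by blast+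
    have "I x z = colour i j"
      by (rule star_thin[OF jik ijk(3,2,4) colour_sym 2(1)[symmetric] x(2,1) assms(8)])
    then show False using 2 assms by (simp add: nbrs_def)
  next
    case 3
    have kij: "distinct [k, i, j]" using ijk by auto
    have z: "x \<in> nbrs k i z" "y \<in> nbrs k j z" "z \<in> \<Omega> k" using assms nbrs_sym nbrs_subset by blast+
    have "I x y = colour i k"
      by (rule star_thin[OF kij ijk(4,2,3) colour_sym _ z(3,1,2)]) (simp add: colour_sym 3(1))
    then show False using 3 assms by (simp add: nbrs_def)
  qed
qed

text \<open>Whether a path of neighbours along \<open>i\<close>, \<open>j\<close>, \<open>k\<close>, \<open>l\<close> can return to its start. Such paths form
a tight set, so one that returns makes all of them return.\<close>

definition closed_cycle :: "nat \<Rightarrow> nat \<Rightarrow> nat \<Rightarrow> nat \<Rightarrow> bool" where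
  "closed_cycle i j k l \<longleftrightarrow> (\<exists>x y z w. x \<in> \<Omega> i \<and> y \<in> nbrs i j x \<and> z \<in> nbrs j k y \<and> w \<in> nbrs k l z \<and> x \<in> nbrs l i w)"

lemma path_constant:
  assumes "distinct [i, j, k, l]" "i \<in> K" "j \<in> K" "k \<in> K" "l \<in> K"
    and "x \<in> \<Omega> i" "y \<in> nbrs i j x" "z \<in> nbrs j k y" "w \<in> nbrs k l z"
    and "x' \<in> \<Omega> i" "y' \<in> nbrs i j x'" "z' \<in> nbrs j k y'" "w' \<in> nbrs k l z'"
  shows "I x w = I x' w'"
  by (rule thin_path[of i j k l "colour i j" "colour j k" "colour k l" x y z w x' y' z' w'])
     (use assms in \<open>auto simp: nbrs_def intro!: thin_colour\<close>)

lemma closed_cycle_closes: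
  assumes "closed_cycle i j k l" "distinct [i, j, k, l]" "i \<in> K" "j \<in> K" "k \<in> K" "l \<in> K"
    and "x \<in> \<Omega> i" "y \<in> nbrs i j x" "z \<in> nbrs j k y" "w \<in> nbrs k l z"
  shows "w \<in> nbrs i l x"
proof -
  obtain x' y' z' w' where p: "x' \<in> \<Omega> i" "y' \<in> nbrs i j x'" "z' \<in> nbrs j k y'" "w' \<in> nbrs k l z'"
    and "x' \<in> nbrs l i w'"
    using assms(1) unfolding closed_cycle_def by blast
  moreover from this have "w' \<in> \<Omega> l" using nbrs_subset by blast
  ultimately have "w' \<in> nbrs i l x'" using nbrs_sym by blast
  moreover have "I x w = I x' w'" by (rule path_constant[OF assms(2-10) p])
  moreover have "w \<in> \<Omega> l" using assms(10) nbrs_subset by blast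
  ultimately show ?thesis by (simp add: nbrs_def)
qed

lemma closed_cycle_rotate: "closed_cycle i j k l \<Longrightarrow> closed_cycle j k l i"
  unfolding closed_cycle_def using nbrs_subset by (elim exE conjE) (intro exI conjI; (assumption | blast))

lemma closed_cycle_reverse: "closed_cycle i j k l \<Longrightarrow> closed_cycle l k j i"
proof -
  assume "closed_cycle i j k l"
  then obtain x y z w where *: "x \<in> \<Omega> i" "y \<in> nbrs i j x" "z \<in> nbrs j k y" "w \<in> nbrs k l z" "x \<in> nbrs l i w"
    unfolding closed_cycle_def by blast
  then have "y \<in> \<Omega> j" "z \<in> \<Omega> k" "w \<in> \<Omega> l" using nbrs_subset by blast+
  then have "w \<in> \<Omega> l" "z \<in> nbrs l k w" "y \<in> nbrs k j z" "x \<in> nbrs j i y" "w \<in> nbrs i l x" using * nbrs_sym by blast+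
  then show ?thesis unfolding closed_cycle_def by blast
qed

text \<open>The neighbours of \<open>y\<close> avoid those of \<open>x\<close> by the absence of triangles and those of \<open>z\<close> since the cycle is
open.\<close>

lemma open_cycle_neighbours:
  assumes d: "distinct [i, j, k, l]" "i \<in> K" "j \<in> K" "k \<in> K" "l \<in> K" and "\<not> closed_cycle i j l k"
    and x: "x \<in> \<Omega> i" "z \<in> nbrs i k x" "y \<in> nbrs i j x"
  shows "nbrs j l y = \<Omega> l - nbrs i l x - nbrs k l z"
proof (rule third_part[of _ "p l"])
  have mem: "z \<in> \<Omega> k" "y \<in> \<Omega> j" using x nbrs_subset by blast+
  then have sym: "x \<in> nbrs k i z" using x nbrs_sym by blast
  show "nbrs i l x \<inter> nbrs k l z = {}" using no_triangle[of i k l x z] d x by auto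
  show "nbrs i l x \<inter> nbrs j l y = {}" using no_triangle[of i j l x y] d x by auto
  show "nbrs k l z \<inter> nbrs j l y = {}"
  proof (rule ccontr)
    assume "\<not> ?thesis"
    then obtain w where w: "w \<in> nbrs j l y" "w \<in> nbrs k l z" by blast
    then have "z \<in> nbrs l k w" using mem nbrs_sym by blast
    then show False using assms(6) x w sym unfolding closed_cycle_def by blast
  qed
  show "card (nbrs i l x) = p l" "card (nbrs j l y) = p l" "card (nbrs k l z) = p l"
    using card_nbrs d x mem by auto
qed (use d in \<open>auto simp: fin card_Omega dest: nbrs_subset[THEN subsetD]\<close>)

text \<open>If both cycles were open, all neighbours of \<open>x\<close> and of \<open>z\<close> in \<open>\<Omega> j\<close> would have the same
neighbourhood in \<open>\<Omega> l\<close>. An element of it would then have two thirds of \<open>\<Omega> j\<close> as neighbours.\<close>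

lemma one_of_two_cycles:
  assumes d: "distinct [i, j, k, l]" "i \<in> K" "j \<in> K" "k \<in> K" "l \<in> K"
  shows "closed_cycle i j l k \<or> closed_cycle i l j k"
proof (rule ccontr)
  assume not: "\<not> ?thesis"
  define x where "x = c True i"
  have x: "x \<in> \<Omega> i" using c_mem d by (simp add: x_def)
  then obtain z where z: "z \<in> nbrs i k x" using nbrs_nonempty d by force
  then have z': "z \<in> \<Omega> k" "x \<in> nbrs k i z" using nbrs_subset nbrs_sym x by blast+
  have "\<not> closed_cycle k j l i" using not closed_cycle_reverse by blast
  define E where "E = \<Omega> l - nbrs i l x - nbrs k l z"
  have E: "nbrs j l y = E" if "y \<in> nbrs i j x \<or> y \<in> nbrs k j z" for y
  proof -
    have "nbrs j l y = E" if "y \<in> nbrs i j x"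
      unfolding E_def using open_cycle_neighbours[OF d _ x z that] not by blast
    moreover have "nbrs j l y = E" if "y \<in> nbrs k j z"
      using open_cycle_neighbours[of k j i l z x y] \<open>\<not> closed_cycle k j l i\<close> d z' that by (auto simp: E_def)
    ultimately show ?thesis using that by blast
  qed
  obtain y where y: "y \<in> nbrs i j x" using nbrs_nonempty x d by force
  then obtain w where w: "w \<in> nbrs j l y" using nbrs_nonempty[of j l y] nbrs_subset d by force
  then have "w \<in> E" "w \<in> \<Omega> l" using E y nbrs_subset by blast+
  have "nbrs i j x \<union> nbrs k j z \<subseteq> nbrs l j w"
  proof
    fix y assume y: "y \<in> nbrs i j x \<union> nbrs k j z"
    then have "w \<in> nbrs j l y" using E \<open>w \<in> E\<close> by blast
    moreover have "y \<in> \<Omega> j" using y nbrs_subset by blast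
    ultimately show "y \<in> nbrs l j w" using nbrs_sym by blast
  qed
  then have "card (nbrs i j x \<union> nbrs k j z) \<le> card (nbrs l j w)" by (rule card_mono[OF finite_nbrs])
  moreover have "card (nbrs l j w) = p j" "card (nbrs i j x) = p j" "card (nbrs k j z) = p j"
    using d x z' \<open>w \<in> \<Omega> l\<close> by (auto intro: card_nbrs)
  moreover have "nbrs i j x \<inter> nbrs k j z = {}" using no_triangle[of i k j x z] d x z by auto
  then have "card (nbrs i j x \<union> nbrs k j z) = card (nbrs i j x) + card (nbrs k j z)"
    by (rule card_Un_disjoint[OF finite_nbrs finite_nbrs])
  moreover have "0 < p j" using p_pos d by blast
  ultimately show False by linarith
qed

text \<open>The colouring consists of a perfect matching \<open>ik\<close>, \<open>jl\<close> and a 4-cycle in the other colour. In the configuration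
of the colour of the matching the only neighbours are those matched. If the cycle were open, the member at \<open>l\<close>
would have exactly the same neighbours in \<open>\<Omega> j\<close> as the one at \<open>i\<close>, among them the member at \<open>j\<close>.\<close>

lemma closed_through_matching:
  assumes d: "distinct [i, j, k, l]" "i \<in> K" "j \<in> K" "k \<in> K" "l \<in> K"
    and colour: "colour i k = b" "colour j l = b" "colour i j = (\<not> b)" "colour j k = (\<not> b)"
      "colour k l = (\<not> b)" "colour l i = (\<not> b)"
  shows "closed_cycle i j l k"
proof (rule ccontr)
  assume not: "\<not> ?thesis"
  let ?c = "c b"
  have mem: "?c i \<in> \<Omega> i" "?c j \<in> \<Omega> j" "?c k \<in> \<Omega> k" "?c l \<in> \<Omega> l" using c_mem d by auto
  have z: "?c k \<in> nbrs i k (?c i)" using mem c_rel d colour by (auto simp: nbrs_def)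
  have "?c l \<in> \<Omega> l - nbrs i l (?c i) - nbrs k l (?c k)"
    using mem c_rel[of i l b] c_rel[of k l b] d colour colour_sym by (auto simp: nbrs_def)
  then have "?c l \<in> nbrs j l y" if "y \<in> nbrs i j (?c i)" for y
    using open_cycle_neighbours[OF d not mem(1) z that] by blast
  then have "nbrs i j (?c i) \<subseteq> nbrs l j (?c l)" using nbrs_sym nbrs_subset by blast
  moreover have "card (nbrs i j (?c i)) = p j" "card (nbrs l j (?c l)) = p j" using card_nbrs mem d by auto
  ultimately have "nbrs i j (?c i) = nbrs l j (?c l)" using finite_nbrs by (intro card_seteq) auto
  moreover have "?c j \<in> nbrs l j (?c l)" using mem c_rel[of l j b] d colour colour_sym by (auto simp: nbrs_def)
  ultimately show False using c_rel[of i j b] d colour by (auto simp: nbrs_def)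
qed

text \<open>Fix \<open>x\<close> in \<open>\<Omega> i\<close>. At each other index there are the neighbours of \<open>x\<close>, the second neighbours of \<open>x\<close>, and a remaining
third. Closedness makes the set of second neighbours independent of the index and the
element through which they are reached. The neighbours of an element of a remaining third must then be exactly the
elements of the other remaining thirds, so elements of the three remaining thirds form a triangle.\<close>

lemma not_all_cycles_closed:
  assumes ijkl: "distinct [i, j, k, l]" "i \<in> K" "j \<in> K" "k \<in> K" "l \<in> K"
    and closed: "\<And>i j k l. distinct [i, j, k, l] \<Longrightarrow> i \<in> K \<Longrightarrow> j \<in> K \<Longrightarrow> k \<in> K \<Longrightarrow> l \<in> K \<Longrightarrow> closed_cycle i j k l"
  shows False
proof -
  define x where "x = c True i"
  have x: "x \<in> \<Omega> i" using c_mem ijkl by (simp add: x_def)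
  define T where "T = K - {i}"
  have T: "m \<in> K" "m \<noteq> i" if "m \<in> T" for m using that by (auto simp: T_def)
  have second: "nbrs m s u = nbrs m' s u'"
    if m: "distinct [m, m', s]" "m \<in> T" "m' \<in> T" "s \<in> T" and u: "u \<in> nbrs i m x" "u' \<in> nbrs i m' x" for m m' s u u'
  proof (rule card_seteq[OF finite_nbrs])
    have u': "u' \<in> \<Omega> m'" "x \<in> nbrs m' i u'" "u \<in> \<Omega> m" using u nbrs_subset nbrs_sym x by blast+
    have "distinct [m', i, m, s]" using m T by auto
    then show "nbrs m s u \<subseteq> nbrs m' s u'"
      using closed_cycle_closes[OF closed _ T(1) ijkl(2) T(1) T(1), OF _ T(1) ijkl(2) T(1) T(1)] m u' u by blast
    have "card (nbrs m s u) = p s" "card (nbrs m' s u') = p s" using m T u' by (auto intro!: card_nbrs)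
    then show "card (nbrs m' s u') \<le> card (nbrs m s u)" by simp
  qed
  have third: "nbrs a b v = \<Omega> b - nbrs i b x - nbrs d b u"
    if abd: "distinct [a, b, d]" "a \<in> T" "b \<in> T" "d \<in> T" and u: "u \<in> nbrs i d x"
      and v: "v \<in> \<Omega> a" "v \<notin> nbrs i a x" "v \<notin> nbrs d a u" for a b d u v
  proof (rule third_part[of _ "p b"])
    have in_K: "a \<in> K" "b \<in> K" "d \<in> K" "distinct [i, d, b, a]" using abd T by auto
    have u': "u \<in> \<Omega> d" using u nbrs_subset by blast
    show "nbrs i b x \<inter> nbrs d b u = {}" using no_triangle[of i d b x u] in_K ijkl x u by auto
    show "nbrs i b x \<inter> nbrs a b v = {}"
    proof (rule ccontr)
      assume "\<not> ?thesis"
      then obtain w where w: "w \<in> nbrs i b x" "w \<in> nbrs a b v" by blast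
      have "nbrs b a w = nbrs d a u" using second[of b d a w u] abd w u by auto
      then show False using v nbrs_sym[OF v(1) w(2)] by simp
    qed
    show "nbrs d b u \<inter> nbrs a b v = {}"
    proof (rule ccontr)
      assume "\<not> ?thesis"
      then obtain w where w: "w \<in> nbrs d b u" "w \<in> nbrs a b v" by blast
      have "closed_cycle i d b a" using closed in_K ijkl by blast
      then have "v \<in> nbrs i a x"
        using closed_cycle_closes[of i d b a x u w v] in_K ijkl x u w nbrs_sym[OF v(1) w(2)] by blast
      then show False using v by blast
    qed
    show "card (nbrs i b x) = p b" "card (nbrs d b u) = p b" "card (nbrs a b v) = p b"
      using in_K ijkl x u' v by (auto intro!: card_nbrs)
    show "card (\<Omega> b) = 3 * p b" using card_Omega in_K by blast
  qed (fact fin nbrs_subset)+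
  have t: "j \<in> T" "k \<in> T" "l \<in> T" "distinct [j, k, l]" using ijkl by (auto simp: T_def)
  obtain y z w where u: "y \<in> nbrs i j x" "z \<in> nbrs i k x" "w \<in> nbrs i l x"
    using nbrs_nonempty[OF ijkl(2) _ _ x] ijkl by force
  have S: "nbrs j l y = nbrs k l z" "nbrs j k y = nbrs l k w" "nbrs k j z = nbrs l j w"
    using second[of j k l y z] second[of j l k y w] second[of k l j z w] t u by auto
  have mem: "y \<in> \<Omega> j" "z \<in> \<Omega> k" "w \<in> \<Omega> l" using u nbrs_subset by blast+
  have rest: "\<exists>v. v \<in> \<Omega> s \<and> v \<notin> nbrs i s x \<and> v \<notin> nbrs m s u"
    if "m \<in> T" "s \<in> T" "m \<noteq> s" "u \<in> \<Omega> m" for m s u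
  proof -
    have "card (nbrs i s x) = p s" "card (nbrs m s u) = p s" using that T x ijkl by (auto intro!: card_nbrs)
    then show ?thesis using nonempty_third_part[OF fin card_Omega p_pos] T that by metis
  qed
  obtain yy where yy: "yy \<in> \<Omega> j" "yy \<notin> nbrs i j x" "yy \<notin> nbrs l j w" using rest[of l j w] t mem by auto
  obtain zz where zz: "zz \<in> \<Omega> k" "zz \<notin> nbrs i k x" "zz \<notin> nbrs l k w" using rest[of l k w] t mem by auto
  obtain ww where ww: "ww \<in> \<Omega> l" "ww \<notin> nbrs i l x" "ww \<notin> nbrs k l z" using rest[of k l z] t mem by auto
  have "zz \<in> nbrs j k yy" using third[of j k l w yy] t u yy zz by auto
  moreover have "ww \<in> nbrs j l yy" using third[of j l k z yy] t u yy ww S by auto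
  moreover have "ww \<in> nbrs k l zz" using third[of k l j y zz] t u zz ww S by auto
  moreover have "distinct [j, k, l]" by fact
  ultimately show False using no_triangle[of j k l yy zz ww] ijkl yy by blast
qed

text \<open>Each colour class is a path of three edges. The configuration of that colour realises the path
without the closing edge, so two of the 4-cycles are open. Both run through the edges \<open>jk\<close> and \<open>il\<close>.\<close>

lemma impossible_path:
  assumes ijkl: "distinct [i, j, k, l]" "i \<in> K" "j \<in> K" "k \<in> K" "l \<in> K"
    and colour: "colour i j = b" "colour j k = b" "colour k l = b" "colour l i = (\<not> b)" "colour i k = (\<not> b)" "colour j l = (\<not> b)"
  shows False
proof -
  have closing: "\<not> closed_cycle i j k l"
    if ijkl: "distinct [i, j, k, l]" "i \<in> K" "j \<in> K" "k \<in> K" "l \<in> K"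
      and colour: "colour i j = b" "colour j k = b" "colour k l = b" "colour l i = (\<not> b)" for i j k l b
  proof
    assume "closed_cycle i j k l"
    have mem: "c b i \<in> \<Omega> i" "c b j \<in> nbrs i j (c b i)" "c b k \<in> nbrs j k (c b j)" "c b l \<in> nbrs k l (c b k)"
      using ijkl c_mem c_rel colour by (auto simp: nbrs_def)
    have "c b l \<in> nbrs i l (c b i)" by (rule closed_cycle_closes[OF \<open>closed_cycle i j k l\<close> ijkl mem])
    then show False using c_rel[of i l b] ijkl colour colour_sym[of i l] by (auto simp: nbrs_def)
  qed
  have "\<not> closed_cycle i j k l" using closing[OF ijkl colour(1-4)] .
  then have "\<not> closed_cycle j i l k" using closed_cycle_reverse closed_cycle_rotate by blast
  moreover have "\<not> closed_cycle j l i k"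
    by (rule closing[where b = "\<not> b"]) (use ijkl colour colour_sym in auto)
  moreover have "closed_cycle j i l k \<or> closed_cycle j l i k"
    by (rule one_of_two_cycles) (use ijkl in auto)
  ultimately show False by blast
qed

text \<open>One of the three 4-cycles is monochromatic and therefore closed by the configuration of its colour; the other two
are closed because they pass through the matching.\<close>

lemma impossible_cycle:
  assumes ijkl: "distinct [i, j, k, l]" "i \<in> K" "j \<in> K" "k \<in> K" "l \<in> K" and K: "K = {i, j, k, l}"
    and colour: "colour i k = b" "colour j l = b" "colour i j = (\<not> b)" "colour j k = (\<not> b)"
      "colour k l = (\<not> b)" "colour l i = (\<not> b)"
  shows False
proof (rule not_all_cycles_closed[OF ijkl])
  have 1: "closed_cycle i j l k" by (rule closed_through_matching[OF ijkl colour])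
  have "closed_cycle k j l i" by (rule closed_through_matching[of k j i l b]) (use ijkl colour colour_sym in auto)
  then have 2: "closed_cycle i l j k" by (rule closed_cycle_reverse)
  have "c (\<not> b) i \<in> \<Omega> i \<and> c (\<not> b) j \<in> nbrs i j (c (\<not> b) i) \<and> c (\<not> b) k \<in> nbrs j k (c (\<not> b) j) \<and>
    c (\<not> b) l \<in> nbrs k l (c (\<not> b) k) \<and> c (\<not> b) i \<in> nbrs l i (c (\<not> b) l)"
    using ijkl c_mem c_rel colour by (auto simp: nbrs_def)
  then have 3: "closed_cycle i j k l" unfolding closed_cycle_def by blast
  have rot: "closed_cycle a b c d = closed_cycle b c d a" and rev: "closed_cycle a b c d = closed_cycle d c b a" for a b c d
    using closed_cycle_rotate closed_cycle_reverse by blast+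
  have e: "closed_cycle i j k l" "closed_cycle i j l k" "closed_cycle i k j l" "closed_cycle i l k j" "closed_cycle i k l j" "closed_cycle i l j k"
    using 1 2 3 rot rev by metis+
  have from_i: "closed_cycle i x y z" if "distinct [x, y, z]" "x \<in> {j, k, l}" "y \<in> {j, k, l}" "z \<in> {j, k, l}" for x y z
    using that e by (elim insertE emptyE) simp_all
  show "closed_cycle a b d e" if abde: "distinct [a, b, d, e]" "a \<in> K" "b \<in> K" "d \<in> K" "e \<in> K" for a b d e
  proof -
    have "i = a \<or> i = b \<or> i = d \<or> i = e"
    proof (rule ccontr)
      assume "\<not> ?thesis"
      then have "{a, b, d, e} \<subseteq> {j, k, l}" using abde K by auto
      then have "card {a, b, d, e} \<le> card {j, k, l}" by (intro card_mono) auto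
      also have "\<dots> \<le> 3" by (simp add: card_insert_if)
      finally show False using abde(1) by simp
    qed
    then show ?thesis
    proof (elim disjE)
      assume "i = a"
      then show ?thesis using from_i[of b d e] abde K by auto
    next
      assume "i = b"
      then have "closed_cycle b d e a" using from_i[of d e a] abde K by auto
      then show ?thesis using rot by metis
    next
      assume "i = d"
      then have "closed_cycle d e a b" using from_i[of e a b] abde K by auto
      then show ?thesis using rot by metis
    next
      assume "i = e"
      then have "closed_cycle e a b d" using from_i[of a b d] abde K by auto
      then show ?thesis using rot by metis
    qed
  qed
qed

text \<open>Without monochromatic stars each vertex has one edge of one colour and two of the other. Starting from the
single edge at \<open>i\<close>, the colouring is a path and its complement or a matching and its complement.\<close>

lemma impossible_minority:
  assumes ijkl: "distinct [i, j, k, l]" "i \<in> K" "j \<in> K" "k \<in> K" "l \<in> K" and K: "K = {i, j, k, l}"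
    and colour: "colour i j = b" "colour i k = (\<not> b)" "colour i l = (\<not> b)"
  shows False
proof -
  have ne: "i \<noteq> j" "i \<noteq> k" "i \<noteq> l" "j \<noteq> k" "j \<noteq> l" "k \<noteq> l" using ijkl(1) by auto
  have colour': "colour j i = b" "colour k i = (\<not> b)" "colour l i = (\<not> b)" using colour by (simp_all only: colour_sym[of _ i])
  have kl: "colour k l = b" if "colour j k = (\<not> b) \<or> colour j l = (\<not> b)"
  proof (rule ccontr)
    assume "colour k l \<noteq> b"
    then have kl: "colour k l = (\<not> b)" "colour l k = (\<not> b)" by (simp_all only: colour_sym[of l k]) blast+
    show False using that
    proof
      assume "colour j k = (\<not> b)"
      then have "colour k j = (\<not> b)" by (simp only: colour_sym[of k j])
      then show False using no_monochromatic_star[of i j l k "\<not> b"] ijkl ne colour' kl by simp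
    next
      assume "colour j l = (\<not> b)"
      then have "colour l j = (\<not> b)" by (simp only: colour_sym[of l j])
      then show False using no_monochromatic_star[of i j k l "\<not> b"] ijkl ne colour' kl by simp
    qed
  qed
  then have lk: "colour l k = b" if "colour j k = (\<not> b) \<or> colour j l = (\<not> b)" using that by (simp only: colour_sym[of l k])
  have "colour j k = (\<not> b) \<or> colour j l = (\<not> b)"
    using no_monochromatic_star[of i k l j b] ijkl ne colour' by auto
  then consider "colour j k = b" "colour j l = (\<not> b)" | "colour j k = (\<not> b)" "colour j l = b"
    | "colour j k = (\<not> b)" "colour j l = (\<not> b)" by (cases b) auto
  then show False
  proof cases
    case 1
    then show False using impossible_path[of i j k l b] ijkl colour colour' kl by simp
  next
    case 2
    then show False using impossible_path[of i j l k b] ijkl ne colour colour' lk by simp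
  next
    case 3
    have "colour l j = (\<not> b)" "colour k j = (\<not> b)" using 3 by (simp_all only: colour_sym[of _ j])
    then show False using impossible_cycle[of i k j l b] ijkl ne K colour colour' kl 3 by (simp add: insert_commute)
  qed
qed

lemma contradiction: False
proof -
  obtain i j k l where K: "K = {i, j, k, l}" and d: "distinct [i, j, k, l]"
  proof -
    obtain i L where 1: "K = insert i L" "i \<notin> L" "card L = 3"
      using card_K card_eq_SucD[of K 3] by auto
    obtain j M where 2: "L = insert j M" "j \<notin> M" "card M = 2"
      using 1(3) card_eq_SucD[of L 2] by auto
    then obtain k l where "M = {k, l}" "k \<noteq> l" by (auto simp: card_2_iff)
    then show thesis using 1 2 that[of i j k l] by auto
  qed
  have mem: "i \<in> K" "j \<in> K" "k \<in> K" "l \<in> K" using K by auto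
  have ne: "i \<noteq> j" "i \<noteq> k" "i \<noteq> l" "j \<noteq> k" "j \<noteq> l" "k \<noteq> l" using d by auto
  have star: "\<not> (colour i j = colour i k \<and> colour i k = colour i l)"
    using no_monochromatic_star[of j k l i "colour i j"] mem ne by auto
  consider "colour i k = (\<not> colour i j)" "colour i l = (\<not> colour i j)" | "colour i j = (\<not> colour i k)" "colour i l = (\<not> colour i k)"
    | "colour i j = (\<not> colour i l)" "colour i k = (\<not> colour i l)"
    using star by (cases "colour i j"; cases "colour i k"; cases "colour i l") simp_all
  then show False
  proof cases
    case 1
    then show False using impossible_minority[OF d mem K refl] by blast
  next
    case 2
    have "K = {i, k, j, l}" using K by auto
    then show False using impossible_minority[OF _ _ _ _ _ _ refl 2] mem ne by simp
  next
    case 3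
    have "K = {i, l, j, k}" using K by auto
    then show False using impossible_minority[OF _ _ _ _ _ _ refl 3] mem ne by simp
  qed
qed

end

section \<open>Three mutual gcds equal to four and three equal to two\<close>

text \<open>The set \<open>M\<close> holds the three indices with mutual gcds 4, and \<open>l\<close> is the remaining one.\<close>

locale gcds_four_and_two = two_configurations \<Phi> \<Omega> I n c
  for \<Phi> :: "('x \<Rightarrow> 'x) set" and \<Omega> :: "nat \<Rightarrow> 'x set" and I :: "'x \<Rightarrow> 'x \<Rightarrow> bool"
    and n :: nat and c :: "bool \<Rightarrow> nat \<Rightarrow> 'x" +
  fixes M :: "nat set" and l :: nat and p :: "nat \<Rightarrow> nat" and w :: nat
  assumes M: "m \<in> M \<Longrightarrow> m < n" and l: "l < n" "l \<notin> M"
    and card_M: "m \<in> M \<Longrightarrow> card (\<Omega> m) = 4 * p m" and card_l: "card (\<Omega> l) = 2 * w"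
    and coprime_p: "m \<in> M \<Longrightarrow> m' \<in> M \<Longrightarrow> m \<noteq> m' \<Longrightarrow> coprime (p m) (p m')"
    and coprime_w: "m \<in> M \<Longrightarrow> coprime (p m) w" and odd_w: "odd w"
begin

lemma halves:
  assumes "m \<in> M"
  shows "\<And>x s. x \<in> \<Omega> m \<Longrightarrow> card {v \<in> \<Omega> l. I x v = s} = w"
    and "\<And>v s. v \<in> \<Omega> l \<Longrightarrow> card {x \<in> \<Omega> m. I x v = s} = 2 * p m"
proof -
  have "m \<noteq> l" "card (\<Omega> m) = 2 * (2 * p m)" "coprime (2 * p m) w"
    using assms l card_M coprime_w odd_w by (auto simp: coprime_left_2_iff_odd)
  then obtain \<kappa> where \<kappa>: "\<And>x b. x \<in> \<Omega> m \<Longrightarrow> card {y \<in> \<Omega> l. I x y = b} = \<kappa> b * w"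
    "\<And>y b. y \<in> \<Omega> l \<Longrightarrow> card {x \<in> \<Omega> m. I y x = b} = \<kappa> b * (2 * p m)"
    "\<kappa> True + \<kappa> False = 2" "\<And>b. 0 < \<kappa> b"
    using pair_degrees[OF M[OF assms] l(1) _ _ card_l] by blast
  have "\<kappa> True = 1" "\<kappa> False = 1" using \<kappa>(3) \<kappa>(4)[of True] \<kappa>(4)[of False] by linarith+
  then have one: "\<kappa> b = 1" for b by (cases b) auto
  show "card {v \<in> \<Omega> l. I x v = s} = w" if "x \<in> \<Omega> m" for x s using \<kappa>(1)[OF that] one by simp
  show "card {x \<in> \<Omega> m. I x v = s} = 2 * p m" if "v \<in> \<Omega> l" for v s
    using \<kappa>(2)[OF that, of s] one by (simp add: I_sym)
qed

text \<open>Both \<open>x\<close> and \<open>y\<close> are related to exactly half of \<open>\<Omega> l\<close>, so the elements related to both are as many as those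
related to none.\<close>

lemma equal_signs:
  assumes "m \<in> M" "m' \<in> M" and x: "x \<in> \<Omega> m" "y \<in> \<Omega> m'"
    and ex: "\<exists>v\<in>\<Omega> l. I x v = b \<and> I y v = b"
  shows "\<exists>v\<in>\<Omega> l. I x v = (\<not> b) \<and> I y v = (\<not> b)"
proof (rule ccontr)
  assume not: "\<not> ?thesis"
  then have "{v \<in> \<Omega> l. I y v = (\<not> b)} \<subseteq> {v \<in> \<Omega> l. I x v = b}" by blast
  moreover have "card {v \<in> \<Omega> l. I y v = (\<not> b)} = w" "card {v \<in> \<Omega> l. I x v = b} = w"
    using halves(1) assms by blast+
  ultimately have "{v \<in> \<Omega> l. I y v = (\<not> b)} = {v \<in> \<Omega> l. I x v = b}"
    using fin by (intro card_seteq) auto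
  then show False using ex by blast
qed

lemma tight_sign:
  assumes "m \<in> M"
  shows "tight {m, l} (\<lambda>t. I (t m) (t l) = s) (4 * (w * p m))"
proof -
  have m: "m \<noteq> l" using assms l by blast
  have "coprime w (2 * p m)"
    using coprime_w[OF assms] odd_w by (simp add: coprime_commute)
  then have lcm: "lcm (2 * (2 * p m)) (2 * w) = 2 * w * (2 * p m)" by (rule lcm_scaled)
  have "tight {m, l} (\<lambda>t. I (t m) (t l) = s) (card (\<Omega> l) * (2 * p m))"
  proof (rule tight_insert[OF tight_single[of l], where Q = "\<lambda>t y. I y (t l) = s"])
    show "card {y \<in> \<Omega> m. I y (t l) = s} = 2 * p m" if "t \<in> tuples {l} (\<lambda>_. True)" for t
      using that by (intro halves(2)[OF assms]) (auto simp: tuples_def)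
    show "invariant {m, l} (\<lambda>t. I (t m) (t l) = s)" by (rule invariant_I) auto
    show "lcm (card (\<Omega> m)) (card (\<Omega> l)) = card (\<Omega> l) * (2 * p m)"
      using lcm card_M[OF assms] card_l by simp
  qed (use m in auto)
  then show ?thesis by (simp add: card_l mult.assoc)
qed

text \<open>The truth values \<open>s\<close> and \<open>s'\<close> prescribe the halves of \<open>\<Omega> m\<close> and \<open>\<Omega> m'\<close> determined by an element of
\<open>\<Omega> l\<close>. The pair of halves is mixed if both values of \<open>I\<close> occur between them.\<close>

definition mixed :: "nat \<Rightarrow> nat \<Rightarrow> bool \<Rightarrow> bool \<Rightarrow> bool" where
  "mixed m m' s s' \<longleftrightarrow> (\<forall>b. \<exists>x\<in>\<Omega> m. \<exists>y\<in>\<Omega> m'. \<exists>v\<in>\<Omega> l. I x v = s \<and> I y v = s' \<and> I x y = b)"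

lemma mixed_sym: "mixed m m' s s' \<Longrightarrow> mixed m' m s' s"
  unfolding mixed_def using I_sym by metis

text \<open>The count in question does not depend on \<open>x\<close> and \<open>v\<close>, because the pairs with \<open>I x v = s\<close> form a tight set. By
divisibility it is a multiple of \<open>p m'\<close>, positive for either \<open>b\<close>, and the two counts add up to \<open>2 * p m'\<close>.\<close>

lemma mixed_halves:
  assumes m: "m \<in> M" "m' \<in> M" "m \<noteq> m'" and mixed: "mixed m m' s s'"
    and x: "x \<in> \<Omega> m" "v \<in> \<Omega> l" "I x v = s"
  shows "card {y \<in> \<Omega> m'. I y v = s' \<and> I x y = b} = p m'"
proof -
  let ?D = "\<lambda>b x v. card {y \<in> \<Omega> m'. I y v = s' \<and> I x y = b}"
  let ?P = "\<lambda>t. I (t m) (t l) = s"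
  have ne: "m \<noteq> l" "m' \<noteq> l" "m' \<noteq> m" using m l by auto
  note T = tight_sign[OF m(1), of s]
  have const: "?D b x' v' = ?D b x v" if x': "x' \<in> \<Omega> m" "v' \<in> \<Omega> l" "I x' v' = s" for x' v' b
  proof -
    define t where "t x v = (\<lambda>_. undefined)(m := x, l := v)" for x v :: 'x
    have t: "t x v m = x" "t x v l = v" for x v using ne by (auto simp: t_def)
    have mem: "t x v \<in> tuples {m, l} ?P" if "x \<in> \<Omega> m" "v \<in> \<Omega> l" "I x v = s" for x v
      using that ne by (auto simp: t tuples_def t_def PiE_def extensional_def)
    have "(?D b (t x' v' m) (t x' v' l) = ?D b x v) = (?D b (t x v m) (t x v l) = ?D b x v)"
    proof (rule tight_constant[OF T])
      show "invariant {m, l} (\<lambda>t. ?D b (t m) (t l) = ?D b x v)"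
        unfolding invariant_def
      proof (intro ballI)
        fix \<phi> t assume \<phi>: "\<phi> \<in> \<Phi>" and t: "t \<in> PiE {m, l} \<Omega>"
        have "t m \<in> \<Omega> m" "t l \<in> \<Omega> l" using t by (auto intro: PiE_mem)
        then have "?D b (\<phi> (t m)) (\<phi> (t l)) = ?D b (t m) (t l)"
          using I_inv[OF \<phi>] by (intro card_invariant[OF \<phi>]) blast
        then show "(?D b (restrict (\<phi> \<circ> t) {m, l} m) (restrict (\<phi> \<circ> t) {m, l} l) = ?D b x v) =
            (?D b (t m) (t l) = ?D b x v)"
          by simp
      qed
    qed (use mem x x' in blast)+
    then show ?thesis by (simp add: t)
  qed
  have ge: "p m' \<le> ?D b x v" for b
  proof -
    let ?R = "\<lambda>t. I (t m) (t l) = s \<and> I (t m') (t l) = s' \<and> I (t m) (t m') = b"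
    have "card (tuples {m', m, l} ?R) = card (tuples {m, l} ?P) * ?D b x v"
    proof (rule card_tuples_insert[where Q = "\<lambda>t y. I y (t l) = s' \<and> I (t m) y = b"])
      show "?D b (t m) (t l) = ?D b x v" if "t \<in> tuples {m, l} ?P" for t
        using that by (intro const) (auto simp: tuples_def)
    qed (use ne in auto)
    also have "\<dots> = 4 * (w * p m) * ?D b x v" using T by (simp add: tight_def)
    finally have c1: "card (tuples {m', m, l} ?R) = 4 * (w * p m) * ?D b x v" .
    have c2: "(LCM i\<in>{m', m, l}. card (\<Omega> i)) dvd card (tuples {m', m, l} ?R)"
      by (intro LCM_dvd_card_tuples invariant_conj invariant_I) auto
    have c3: "(LCM i\<in>{m', m, l}. card (\<Omega> i)) = 4 * (w * p m) * p m'"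
    proof -
      have "coprime (w * p m) (p m')" using coprime_p[OF m] coprime_w[OF m(2)] by (simp add: coprime_commute)
      then have "lcm (4 * p m') (4 * (w * p m)) = 4 * (w * p m) * p m'" by (rule lcm_scaled)
      moreover have "(LCM i\<in>{m, l}. card (\<Omega> i)) = 4 * (w * p m)" using T unfolding tight_def by blast
      ultimately show ?thesis using card_M[OF m(2)] by simp
    qed
    have "4 * (w * p m) * p m' dvd 4 * (w * p m) * ?D b x v" using c2 unfolding c1 c3 .
    moreover have "0 < w * p m" using card_pos[OF M[OF m(1)]] card_pos[OF l(1)] card_M[OF m(1)] card_l by simp
    ultimately have "p m' dvd ?D b x v" by simp
    moreover have "0 < ?D b x v"
    proof -
      obtain x' y v' where "x' \<in> \<Omega> m" "y \<in> \<Omega> m'" "v' \<in> \<Omega> l" "I x' v' = s" "I y v' = s'" "I x' y = b"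
        using mixed unfolding mixed_def by blast
      then have ne: "{y \<in> \<Omega> m'. I y v' = s' \<and> I x' y = b} \<noteq> {}" and eq: "?D b x' v' = ?D b x v"
        using const by blast+
      have "finite {y \<in> \<Omega> m'. I y v' = s' \<and> I x' y = b}" using fin by simp
      then have "0 < ?D b x' v'" by (rule card_gt_0_iff[THEN iffD2, OF conjI[OF ne]])
      then show ?thesis using eq by simp
    qed
    ultimately show ?thesis by (rule dvd_imp_le)
  qed
  have "{y \<in> \<Omega> m'. I y v = s'} = {y \<in> \<Omega> m'. I y v = s' \<and> I x y = True} \<union> {y \<in> \<Omega> m'. I y v = s' \<and> I x y = False}"
    by blast
  moreover have "card ({y \<in> \<Omega> m'. I y v = s' \<and> I x y = True} \<union> {y \<in> \<Omega> m'. I y v = s' \<and> I x y = False}) =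
      ?D True x v + ?D False x v"
  proof (rule card_Un_disjoint)
    show "{y \<in> \<Omega> m'. I y v = s' \<and> I x y = True} \<inter> {y \<in> \<Omega> m'. I y v = s' \<and> I x y = False} = {}"
      by blast
  qed (simp_all add: fin)
  ultimately have "?D True x v + ?D False x v = card {y \<in> \<Omega> m'. I y v = s'}" by (simp only:)
  also have "\<dots> = 2 * p m'" by (rule halves(2)[OF m(2) x(2)])
  finally have "?D True x v + ?D False x v = 2 * p m'" .
  then have "?D True x v = p m'" "?D False x v = p m'" using ge[of True] ge[of False] by linarith+
  then show ?thesis by (cases b) simp_all
qed

text \<open>Within a sector the relations of mixed halves behave like thin relations: attaching a leaf keeps tightness.\<close>

lemma mixed_star:
  assumes m: "distinct [i, j, k]" "i \<in> M" "j \<in> M" "k \<in> M" and mixed: "mixed i j s1 s2" "mixed i k s1 s3"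
    and x: "x \<in> \<Omega> i" "y \<in> \<Omega> j" "z \<in> \<Omega> k" "v \<in> \<Omega> l" "I x v = s1" "I y v = s2" "I z v = s3"
      "I x y = b" "I x z = b'"
    and x': "x' \<in> \<Omega> i" "y' \<in> \<Omega> j" "z' \<in> \<Omega> k" "v' \<in> \<Omega> l" "I x' v' = s1" "I y' v' = s2" "I z' v' = s3"
      "I x' y' = b" "I x' z' = b'"
  shows "I y z = I y' z'"
proof -
  have ne: "i \<noteq> l" "j \<noteq> l" "k \<noteq> l" using m l by auto
  have cop: "coprime (w * p i) (p j)" "coprime (w * p i * p j) (p k)"
    using m coprime_p coprime_w by (auto simp: coprime_commute)
  let ?P1 = "\<lambda>t. I (t i) (t l) = s1"
  let ?P2 = "\<lambda>t. ?P1 t \<and> I (t j) (t l) = s2 \<and> I (t i) (t j) = b"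
  let ?P3 = "\<lambda>t. ?P2 t \<and> I (t k) (t l) = s3 \<and> I (t i) (t k) = b'"
  have "tight {j, i, l} ?P2 (4 * (w * p i) * p j)"
  proof (rule tight_insert[OF tight_sign, where Q = "\<lambda>t y. I y (t l) = s2 \<and> I (t i) y = b"])
    show "card {y \<in> \<Omega> j. I y (t l) = s2 \<and> I (t i) y = b} = p j" if "t \<in> tuples {i, l} ?P1" for t
      using that m by (intro mixed_halves[OF _ _ _ mixed(1)]) (auto simp: tuples_def)
    show "lcm (card (\<Omega> j)) (4 * (w * p i)) = 4 * (w * p i) * p j"
      using card_M m cop by (simp add: lcm_scaled)
    show "invariant {j, i, l} ?P2" by (intro invariant_conj invariant_I) auto
  qed (use m ne in auto)
  then have "tight {j, i, l} ?P2 (4 * (w * p i * p j))" by (simp add: mult.assoc)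
  then have T: "tight {k, j, i, l} ?P3 (4 * (w * p i * p j) * p k)"
  proof (rule tight_insert[where Q = "\<lambda>t y. I y (t l) = s3 \<and> I (t i) y = b'"])
    show "card {y \<in> \<Omega> k. I y (t l) = s3 \<and> I (t i) y = b'} = p k" if "t \<in> tuples {j, i, l} ?P2" for t
      using that m by (intro mixed_halves[OF _ _ _ mixed(2)]) (auto simp: tuples_def)
    show "lcm (card (\<Omega> k)) (4 * (w * p i * p j)) = 4 * (w * p i * p j) * p k"
      using card_M m cop by (simp add: lcm_scaled)
    show "invariant {k, j, i, l} ?P3" by (intro invariant_conj invariant_I) auto
  qed (use m ne in auto)
  define t where "t x y z v = (\<lambda>_. undefined)(i := x, j := y, k := z, l := v)" for x y z v :: 'x
  have t: "t x y z v i = x" "t x y z v j = y" "t x y z v k = z" "t x y z v l = v" for x y z v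
    using m ne by (auto simp: t_def)
  have ext: "t x y z v \<in> PiE {k, j, i, l} \<Omega>" if "x \<in> \<Omega> i" "y \<in> \<Omega> j" "z \<in> \<Omega> k" "v \<in> \<Omega> l" for x y z v
    using that m ne by (auto simp: t_def PiE_def extensional_def)
  have "(I (t x y z v j) (t x y z v k) = True) = (I (t x' y' z' v' j) (t x' y' z' v' k) = True)"
  proof (rule tight_constant[OF T])
    show "invariant {k, j, i, l} (\<lambda>t. I (t j) (t k) = True)" by (rule invariant_I) auto
    show "t x y z v \<in> tuples {k, j, i, l} ?P3" unfolding tuples_def using ext x by (simp add: t)
    show "t x' y' z' v' \<in> tuples {k, j, i, l} ?P3" unfolding tuples_def using ext x' by (simp add: t)
  qed
  then show ?thesis by (simp add: t)
qed

text \<open>The argument for three gcds 2, carried out within one sector.\<close>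

lemma not_both_triangles:
  assumes m: "distinct [i, j, k]" "i \<in> M" "j \<in> M" "k \<in> M" and mixed: "mixed i k s1 s3" "mixed j k s2 s3"
    and x: "x \<in> \<Omega> i" "y \<in> \<Omega> j" "z \<in> \<Omega> k" "v \<in> \<Omega> l" "I x v = s1" "I y v = s2" "I z v = s3"
      "I x y = b" "I x z = b" "I y z = b"
    and x': "x' \<in> \<Omega> i" "y' \<in> \<Omega> j" "z' \<in> \<Omega> k" "v' \<in> \<Omega> l" "I x' v' = s1" "I y' v' = s2" "I z' v' = s3"
      "I x' y' = (\<not> b)" "I x' z' = (\<not> b)" "I y' z' = (\<not> b)"
  shows False
proof -
  let ?A = "{u \<in> \<Omega> k. I u v = s3 \<and> I x u = (\<not> b)}" and ?B = "{u \<in> \<Omega> k. I u v = s3 \<and> I y u = b}"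
  have ne: "i \<noteq> k" "j \<noteq> k" "distinct [k, i, j]" using m(1) by auto
  have "?A \<subseteq> ?B"
  proof
    fix u assume "u \<in> ?A"
    then have u: "u \<in> \<Omega> k" "I u v = s3" "I u x = (\<not> b)" using I_sym by auto
    have "I y u = b"
    proof (rule ccontr)
      assume "I y u \<noteq> b"
      then have uy: "I u y = (\<not> b)" using I_sym by auto
      have z': "I z' x' = (\<not> b)" "I z' y' = (\<not> b)" using x'(9,10) I_sym by auto
      have "I x y = I x' y'"
        by (rule mixed_star[OF ne(3) m(4,2,3) mixed[THEN mixed_sym] u(1) x(1,2,4) u(2) x(5,6) u(3) uy
              x'(3,1,2,4,7,5,6) z'])
      then show False using x(8) x'(8) by simp
    qed
    then show "u \<in> ?B" using u by simp
  qed
  moreover have "card ?A = p k" by (rule mixed_halves[OF m(2,4) ne(1) mixed(1) x(1,4,5)])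
  moreover have "card ?B = p k" by (rule mixed_halves[OF m(3,4) ne(2) mixed(2) x(2,4,6)])
  ultimately have "?A = ?B" using fin by (intro card_seteq) auto
  moreover have "z \<in> ?B" using x by simp
  ultimately have "I x z = (\<not> b)" by blast
  then show False using x(9) by simp
qed

lemma c_mem: "m \<in> M \<Longrightarrow> c b m \<in> \<Omega> m" "c b l \<in> \<Omega> l"
  using c_in M l by blast+

lemma c_rel: "m \<in> M \<Longrightarrow> m' \<in> M \<Longrightarrow> m \<noteq> m' \<Longrightarrow> I (c b m) (c b m') = b"
  "m \<in> M \<Longrightarrow> I (c b m) (c b l) = b"
  using c_I M l by blast+

lemma mixed_same:
  assumes m: "m \<in> M" "m' \<in> M" "m \<noteq> m'"
  shows "mixed m m' b b"
  unfolding mixed_def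
proof
  fix b'
  have ex: "\<exists>v\<in>\<Omega> l. I (c b' m) v = b' \<and> I (c b' m') v = b'" using c_mem c_rel m by blast
  have "\<exists>v\<in>\<Omega> l. I (c b' m) v = b \<and> I (c b' m') v = b"
  proof (cases "b = b'")
    case False
    then have "b = (\<not> b')" by blast
    then show ?thesis using equal_signs[OF m(1,2) c_mem(1)[OF m(1)] c_mem(1)[OF m(2)] ex] by simp
  qed (use ex in simp)
  then show "\<exists>x\<in>\<Omega> m. \<exists>y\<in>\<Omega> m'. \<exists>v\<in>\<Omega> l. I x v = b \<and> I y v = b \<and> I x y = b'"
    using c_mem(1)[OF m(1)] c_mem(1)[OF m(2)] c_rel(1)[OF m] by blast
qed

text \<open>The sector of \<open>v\<close> in question also contains the three members of the opposite configuration, as \<open>c (\<not> b) l\<close> shows.\<close>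

lemma not_all_opposite:
  assumes m: "distinct [i, j, k]" "i \<in> M" "j \<in> M" "k \<in> M" and v: "v \<in> \<Omega> l"
    "I (c b i) v = (\<not> b)" "I (c b j) v = (\<not> b)" "I (c b k) v = (\<not> b)"
  shows False
proof -
  have ne: "i \<noteq> j" "i \<noteq> k" "j \<noteq> k" using m(1) by auto
  show False
    by (rule not_both_triangles[where x = "c b i" and y = "c b j" and z = "c b k" and v = v and b = b
          and x' = "c (\<not> b) i" and y' = "c (\<not> b) j" and z' = "c (\<not> b) k" and v' = "c (\<not> b) l",
          OF m mixed_same[OF m(2,4) ne(2)] mixed_same[OF m(3,4) ne(3)]])
       (use m ne v c_mem c_rel in simp_all)
qed

text \<open>Some element of \<open>\<Omega> l\<close> takes value \<open>b\<close> with both \<open>c b j\<close> and \<open>c b k\<close>, hence another takes the opposite value with both;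
its value with \<open>c b i\<close> is \<open>b\<close>, as all three cannot be opposite.\<close>

lemma one_agrees:
  assumes m: "distinct [i, j, k]" "i \<in> M" "j \<in> M" "k \<in> M"
  shows "\<exists>v\<in>\<Omega> l. I (c b i) v = b \<and> I (c b j) v = (\<not> b) \<and> I (c b k) v = (\<not> b)"
proof -
  have "\<exists>v\<in>\<Omega> l. I (c b j) v = b \<and> I (c b k) v = b" using c_mem c_rel m by blast
  then obtain v where v: "v \<in> \<Omega> l" "I (c b j) v = (\<not> b)" "I (c b k) v = (\<not> b)"
    using equal_signs[OF m(3,4) c_mem(1)[OF m(3)] c_mem(1)[OF m(4)]] by blast
  then have "I (c b i) v = b" using not_all_opposite[OF m v(1) _ v(2,3)] by blast
  then show ?thesis using v by blast
qed

lemma mixed_different: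
  assumes m: "distinct [i, j, k]" "i \<in> M" "j \<in> M" "k \<in> M"
  shows "mixed i j b (\<not> b)"
  unfolding mixed_def
proof
  fix b'
  have ne: "i \<noteq> j" "distinct [j, i, k]" using m(1) by auto
  have "\<exists>v\<in>\<Omega> l. I (c b' i) v = b \<and> I (c b' j) v = (\<not> b)"
  proof (cases "b' = b")
    case True
    then show ?thesis using one_agrees[OF m, of b'] by blast
  next
    case False
    then have "b' = (\<not> b)" by blast
    then show ?thesis using one_agrees[OF ne(2) m(3,2,4), of b'] by auto
  qed
  then show "\<exists>x\<in>\<Omega> i. \<exists>y\<in>\<Omega> j. \<exists>v\<in>\<Omega> l. I x v = b \<and> I y v = (\<not> b) \<and> I x y = b'"
    using c_mem(1)[OF m(2)] c_mem(1)[OF m(3)] c_rel(1)[OF m(2,3) ne(1)] by blast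
qed

text \<open>By \<open>one_agrees\<close> for the opposite configuration, the sector in question contains three elements with all relations \<open>\<not> b\<close>.\<close>

lemma not_two_agree:
  assumes m: "distinct [i, j, k]" "i \<in> M" "j \<in> M" "k \<in> M" and v: "v \<in> \<Omega> l"
    "I (c b i) v = b" "I (c b j) v = b" "I (c b k) v = (\<not> b)"
  shows False
proof -
  have ne: "i \<noteq> j" "i \<noteq> k" "j \<noteq> k" "distinct [k, i, j]" "distinct [i, k, j]" "distinct [j, k, i]"
    using m(1) by auto
  obtain v' where v': "v' \<in> \<Omega> l" "I (c (\<not> b) k) v' = (\<not> b)" "I (c (\<not> b) i) v' = b" "I (c (\<not> b) j) v' = b"
    using one_agrees[OF ne(4) m(4,2,3), of "\<not> b"] by auto
  show False
    by (rule not_both_triangles[where x = "c b i" and y = "c b j" and z = "c b k" and v = v and b = b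
          and x' = "c (\<not> b) i" and y' = "c (\<not> b) j" and z' = "c (\<not> b) k" and v' = v',
          OF m mixed_different[OF ne(5) m(2,4,3)] mixed_different[OF ne(6) m(3,4,2)]])
       (use m ne v v' c_mem c_rel in simp_all)
qed

text \<open>An element of \<open>\<Omega> l\<close> is related to exactly one or to all three of \<open>c True i\<close>, \<open>c True j\<close>, \<open>c True k\<close>. With \<open>z\<close>
elements of the second kind, $2 w = 3 (w - z) + z$, so $w = 2 z$.\<close>

lemma contradiction:
  assumes m: "distinct [i, j, k]" "i \<in> M" "j \<in> M" "k \<in> M"
  shows False
proof -
  let ?W = "\<lambda>m. {v \<in> \<Omega> l. I (c True m) v = True}"
  define Z where "Z = ?W i \<inter> ?W j \<inter> ?W k"
  have perm: "distinct [i, k, j]" "distinct [j, k, i]" using m(1) by auto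
  have two: "?W i \<inter> ?W j \<subseteq> Z" "?W i \<inter> ?W k \<subseteq> Z" "?W j \<inter> ?W k \<subseteq> Z"
    using not_two_agree[OF m, of _ True] not_two_agree[OF perm(1) m(2,4,3), of _ True]
      not_two_agree[OF perm(2) m(3,4,2), of _ True] unfolding Z_def by blast+
  have f: "finite (?W m)" "finite Z" for m using fin by (simp_all add: Z_def)
  have parts: "card (?W m - Z) = w - card Z" if "m \<in> {i, j, k}" for m
  proof -
    have "Z \<subseteq> ?W m" unfolding Z_def using that by blast
    then have "card (?W m - Z) = card (?W m) - card Z" by (rule card_Diff_subset[OF f(2)])
    moreover have "m \<in> M" using that m by blast
    then have "card (?W m) = w" using halves(1) c_mem(1) by blast
    ultimately show ?thesis by (simp only:)
  qed
  have "\<Omega> l = (?W i - Z) \<union> ((?W j - Z) \<union> ((?W k - Z) \<union> Z))"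
  proof
    show "\<Omega> l \<subseteq> (?W i - Z) \<union> ((?W j - Z) \<union> ((?W k - Z) \<union> Z))"
      using not_all_opposite[OF m, of _ True] by blast
  qed (auto simp: Z_def)
  then have "card (\<Omega> l) = card ((?W i - Z) \<union> ((?W j - Z) \<union> ((?W k - Z) \<union> Z)))"
    by (rule arg_cong)
  also have "\<dots> = card (?W i - Z) + card ((?W j - Z) \<union> ((?W k - Z) \<union> Z))"
    by (rule card_Un_disjoint; (intro finite_Diff finite_UnI f)?) (use two in blast)
  also have "card ((?W j - Z) \<union> ((?W k - Z) \<union> Z)) = card (?W j - Z) + card ((?W k - Z) \<union> Z)"
    by (rule card_Un_disjoint; (intro finite_Diff finite_UnI f)?) (use two in blast)
  also have "card ((?W k - Z) \<union> Z) = card (?W k - Z) + card Z"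
    by (rule card_Un_disjoint; (intro finite_Diff finite_UnI f)?) blast
  finally have "2 * w = card (?W i - Z) + (card (?W j - Z) + (card (?W k - Z) + card Z))"
    unfolding card_l .
  also have "\<dots> = (w - card Z) + ((w - card Z) + ((w - card Z) + card Z))"
    using parts[of i] parts[of j] parts[of k] by (simp only: insert_iff simp_thms)
  finally have "2 * w = (w - card Z) + ((w - card Z) + ((w - card Z) + card Z))" .
  moreover have "card Z \<le> w"
  proof -
    have "card Z \<le> card (?W i)" by (rule card_mono[OF f(1)]) (auto simp: Z_def)
    also have "\<dots> = w" by (rule halves(1)[OF m(2) c_mem(1)[OF m(2)]])
    finally show ?thesis .
  qed
  ultimately have "w = 2 * card Z" by simp
  then show False using odd_w by simp
qed

end

section \<open>Cosets of finite index\<close>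

lemma (in group) coset_translation_inj:
  assumes "h \<in> carrier G" "C \<subseteq> carrier G" "D \<subseteq> carrier G" "h <#\<^bsub>G\<^esub> C = h <#\<^bsub>G\<^esub> D"
  shows "C = D"
proof -
  have "inv h <#\<^bsub>G\<^esub> (h <#\<^bsub>G\<^esub> B) = B" if "B \<subseteq> carrier G" for B
    using lcos_m_assoc[OF that inv_closed[OF assms(1)] assms(1)] lcos_mult_one[OF that] assms(1) by simp
  then show ?thesis using assms(2-4) by metis
qed

lemma (in group) cosets_meet_translate:
  assumes "h \<in> carrier G" "C \<subseteq> carrier G" "D \<subseteq> carrier G"
  shows "(h <#\<^bsub>G\<^esub> C) \<inter> (h <#\<^bsub>G\<^esub> D) \<noteq> {} \<longleftrightarrow> C \<inter> D \<noteq> {}"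
proof
  assume "(h <#\<^bsub>G\<^esub> C) \<inter> (h <#\<^bsub>G\<^esub> D) \<noteq> {}"
  then obtain x y where "x \<in> C" "y \<in> D" "h \<otimes> x = h \<otimes> y" by (auto simp: l_coset_def)
  moreover from this have "x = y" using assms l_cancel by blast
  ultimately show "C \<inter> D \<noteq> {}" by blast
qed (auto simp: l_coset_def)

text \<open>Indices from \<open>n\<close> on get the empty set, on which the requirements hold vacuously.\<close>

lemma (in group) two_configurations_of_cosets:
  fixes U :: "nat \<Rightarrow> 'a set" and g :: "nat \<Rightarrow> 'a" and n :: nat
  assumes U: "\<And>i. i < n \<Longrightarrow> subgroup (U i) G" and g: "\<And>i. i < n \<Longrightarrow> g i \<in> carrier G"
    and fin: "\<And>i. i < n \<Longrightarrow> finite (lcosets\<^bsub>G\<^esub> (U i))"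
    and disj: "\<And>i j. i < n \<Longrightarrow> j < n \<Longrightarrow> i \<noteq> j \<Longrightarrow> (g i <#\<^bsub>G\<^esub> U i) \<inter> (g j <#\<^bsub>G\<^esub> U j) = {}"
  shows "two_configurations ((\<lambda>h C. h <#\<^bsub>G\<^esub> C) ` carrier G) (\<lambda>i. if i < n then lcosets\<^bsub>G\<^esub> (U i) else {})
    (\<lambda>C D. C \<inter> D \<noteq> {}) n (\<lambda>b i. if b then U i else g i <#\<^bsub>G\<^esub> U i)"
proof
  have sub: "C \<subseteq> carrier G" if "C \<in> (if i < n then lcosets\<^bsub>G\<^esub> (U i) else {})" for C i
    using that U[of i] by (auto simp: LCOSETS_def l_coset_def split: if_splits dest: subgroup.mem_carrier)
  show "finite (if i < n then lcosets\<^bsub>G\<^esub> (U i) else {})" for i using fin by simp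
  show "\<phi> C \<in> (if i < n then lcosets\<^bsub>G\<^esub> (U i) else {})"
    if \<phi>: "\<phi> \<in> (\<lambda>h C. h <#\<^bsub>G\<^esub> C) ` carrier G" and C: "C \<in> (if i < n then lcosets\<^bsub>G\<^esub> (U i) else {})" for \<phi> C i
  proof -
    obtain h where h: "h \<in> carrier G" "\<phi> = (\<lambda>C. h <#\<^bsub>G\<^esub> C)" using \<phi> by blast
    obtain x where x: "i < n" "x \<in> carrier G" "C = x <#\<^bsub>G\<^esub> U i"
      using C by (auto simp: LCOSETS_def split: if_splits)
    have "h <#\<^bsub>G\<^esub> C = (h \<otimes> x) <#\<^bsub>G\<^esub> U i"
      using lcos_m_assoc[OF subgroup.subset[OF U[OF x(1)]] h(1) x(2)] x(3) by simp
    then show ?thesis using x h by (auto simp: LCOSETS_def)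
  qed
  show "inj_on \<phi> (if i < n then lcosets\<^bsub>G\<^esub> (U i) else {})" if \<phi>: "\<phi> \<in> (\<lambda>h C. h <#\<^bsub>G\<^esub> C) ` carrier G" for \<phi> i
  proof (rule inj_onI)
    fix C D
    assume CD: "C \<in> (if i < n then lcosets\<^bsub>G\<^esub> (U i) else {})" "D \<in> (if i < n then lcosets\<^bsub>G\<^esub> (U i) else {})" "\<phi> C = \<phi> D"
    obtain h where "h \<in> carrier G" "\<phi> = (\<lambda>C. h <#\<^bsub>G\<^esub> C)" using \<phi> by blast
    then show "C = D" using coset_translation_inj[OF _ sub[OF CD(1)] sub[OF CD(2)]] CD(3) by simp
  qed
  show "\<exists>\<phi>\<in>(\<lambda>h C. h <#\<^bsub>G\<^esub> C) ` carrier G. \<phi> C = D"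
    if C: "C \<in> (if i < n then lcosets\<^bsub>G\<^esub> (U i) else {})" and D: "D \<in> (if i < n then lcosets\<^bsub>G\<^esub> (U i) else {})" for C D i
  proof -
    obtain x where x: "i < n" "x \<in> carrier G" "C = x <#\<^bsub>G\<^esub> U i"
      using C by (auto simp: LCOSETS_def split: if_splits)
    obtain y where y: "y \<in> carrier G" "D = y <#\<^bsub>G\<^esub> U i"
      using D by (auto simp: LCOSETS_def split: if_splits)
    have "(y \<otimes> inv x) <#\<^bsub>G\<^esub> C = (y \<otimes> inv x \<otimes> x) <#\<^bsub>G\<^esub> U i"
      using lcos_m_assoc[OF subgroup.subset[OF U[OF x(1)]] _ x(2), of "y \<otimes> inv x"] x y by simp
    also have "\<dots> = D" using x y by (simp add: m_assoc)
    finally show ?thesis using x y by blast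
  qed
  show "(\<phi> C \<inter> \<phi> D \<noteq> {}) = (C \<inter> D \<noteq> {})"
    if "\<phi> \<in> (\<lambda>h C. h <#\<^bsub>G\<^esub> C) ` carrier G" and C: "C \<in> (if i < n then lcosets\<^bsub>G\<^esub> (U i) else {})"
      and D: "D \<in> (if j < n then lcosets\<^bsub>G\<^esub> (U j) else {})" for \<phi> C D i j
    using that(1) cosets_meet_translate[OF _ sub[OF C] sub[OF D]] by blast
  show "(C \<inter> D \<noteq> {}) = (D \<inter> C \<noteq> {})" for C D :: "'a set" by blast
  show "(if b then U i else g i <#\<^bsub>G\<^esub> U i) \<in> (if i < n then lcosets\<^bsub>G\<^esub> (U i) else {})" if "i < n" for b i
  proof -
    have "U i = \<one> <#\<^bsub>G\<^esub> U i" using lcos_mult_one subgroup.subset[OF U[OF that]] by simp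
    then show ?thesis using that g by (auto simp: LCOSETS_def)
  qed
  show "((if b then U i else g i <#\<^bsub>G\<^esub> U i) \<inter> (if b then U j else g j <#\<^bsub>G\<^esub> U j) \<noteq> {}) = b"
    if ij: "i < n" "j < n" "i \<noteq> j" for b i j
  proof -
    have "\<one> \<in> U i \<inter> U j" using ij subgroup.one_closed[OF U] by blast
    then show ?thesis using disj[OF ij] by auto
  qed
qed

lemma coprime_quotients:
  fixes a b g p q :: nat
  assumes "gcd a b = g" "a = g * p" "b = g * q" "0 < g"
  shows "coprime p q"
proof -
  have "g * gcd p q = g" using assms by (simp add: gcd_mult_distrib_nat)
  then show ?thesis using assms(4) by (simp add: coprime_iff_gcd_eq_1)
qed

context two_configurations
begin

lemma equal_gcds_quotients:
  assumes "\<And>i. i \<in> K \<Longrightarrow> i < n" "0 < g"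
    and gcd: "\<And>i j. i \<in> K \<Longrightarrow> j \<in> K \<Longrightarrow> i \<noteq> j \<Longrightarrow> gcd (card (\<Omega> i)) (card (\<Omega> j)) = g"
    and two: "\<And>i. i \<in> K \<Longrightarrow> \<exists>j\<in>K. j \<noteq> i"
  shows "equal_gcds \<Phi> \<Omega> I n c K g (\<lambda>i. card (\<Omega> i) div g)"
proof
  show quot: "card (\<Omega> i) = g * (card (\<Omega> i) div g)" if i: "i \<in> K" for i
  proof -
    obtain j where "j \<in> K" "j \<noteq> i" using two[OF i] by blast
    then have "gcd (card (\<Omega> i)) (card (\<Omega> j)) = g" using gcd i by blast
    then have "g dvd card (\<Omega> i)" using gcd_dvd1 by blast
    then show ?thesis by simp
  qed
  show "coprime (card (\<Omega> i) div g) (card (\<Omega> j) div g)" if "i \<in> K" "j \<in> K" "i \<noteq> j" for i j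
    by (rule coprime_quotients[OF gcd[OF that] quot quot assms(2)]) (use that in blast)+
qed (fact assms)+

lemma no_gcds_222:
  assumes "i < n" "j < n" "k < n" "distinct [i, j, k]"
    and "gcd (card (\<Omega> i)) (card (\<Omega> j)) = 2" "gcd (card (\<Omega> j)) (card (\<Omega> k)) = 2"
      "gcd (card (\<Omega> i)) (card (\<Omega> k)) = 2"
  shows False
proof -
  interpret equal_gcds \<Phi> \<Omega> I n c "{i, j, k}" 2 "\<lambda>i. card (\<Omega> i) div 2"
    by (rule equal_gcds_quotients) (use assms in \<open>auto simp: gcd.commute\<close>)
  show False using no_triple_of_gcd_two[of i j k] assms(4) by simp
qed

lemma not_all_gcds_3:
  assumes "4 \<le> n" "\<And>i j. i < 4 \<Longrightarrow> j < 4 \<Longrightarrow> i \<noteq> j \<Longrightarrow> gcd (card (\<Omega> i)) (card (\<Omega> j)) = 3"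
  shows False
proof -
  have two: "\<exists>j\<in>{..<4}. j \<noteq> i" for i :: nat
    by (rule bexI[of _ "if i = 0 then 1 else 0"]) auto
  interpret four_gcds_three \<Phi> \<Omega> I n c "{..<4}" "\<lambda>i. card (\<Omega> i) div 3"
    unfolding four_gcds_three_def four_gcds_three_axioms_def gcds_three_def
    using equal_gcds_quotients[of "{..<4}" 3] assms two by simp
  show False by (rule contradiction)
qed

text \<open>The cofactor \<open>w\<close> of the fourth entry is odd, as otherwise 4 would divide a gcd that is 2.\<close>

lemma no_gcds_444222:
  assumes "distinct [i, j, k, l]" "i < n" "j < n" "k < n" "l < n"
    and four: "gcd (card (\<Omega> i)) (card (\<Omega> j)) = 4" "gcd (card (\<Omega> i)) (card (\<Omega> k)) = 4"
      "gcd (card (\<Omega> j)) (card (\<Omega> k)) = 4"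
    and two: "gcd (card (\<Omega> i)) (card (\<Omega> l)) = 2" "gcd (card (\<Omega> j)) (card (\<Omega> l)) = 2"
      "gcd (card (\<Omega> k)) (card (\<Omega> l)) = 2"
  shows False
proof -
  let ?M = "{i, j, k}" and ?p = "\<lambda>m. card (\<Omega> m) div 4" and ?w = "card (\<Omega> l) div 2"
  interpret E: equal_gcds \<Phi> \<Omega> I n c ?M 4 ?p
    by (rule equal_gcds_quotients) (use assms in \<open>auto simp: gcd.commute\<close>)
  have l: "card (\<Omega> l) = 2 * ?w" using two(1) by (metis dvd_mult_div_cancel gcd_dvd2)
  have cop: "coprime (2 * ?p m) ?w" if m: "m \<in> ?M" for m
  proof (rule coprime_quotients[OF _ _ l])
    show "gcd (card (\<Omega> m)) (card (\<Omega> l)) = 2" using m two by auto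
    show "card (\<Omega> m) = 2 * (2 * ?p m)" using E.card_Omega[OF m] by simp
  qed simp
  interpret gcds_four_and_two \<Phi> \<Omega> I n c ?M l ?p ?w
  proof
    show "coprime (?p m) ?w" if "m \<in> ?M" for m using cop[OF that] by simp
    show "odd ?w" using cop[of i] by simp
    show "l \<notin> ?M" using assms(1) by auto
  qed (fact E.K E.card_Omega E.coprime_p l assms)+
  show False using contradiction[of i j k] assms(1) by simp
qed

end

theorem theoremB:
  fixes G :: "('g, 'b) monoid_scheme" and n :: nat and a :: "nat list"
  assumes "group G"
    and "1 \<le> n" and "n \<le> 4"
    and "length a = n"
    and "\<forall>i<n. a ! i > 0"
    and "harmonic G a"
  shows "harmonic integer_group a"
proof -
  interpret group G by fact
  obtain U g where "\<forall>i<length a. subgroup (U i) G \<and> g i \<in> carrier G \<and>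
      finite (lcosets\<^bsub>G\<^esub> (U i)) \<and> card (lcosets\<^bsub>G\<^esub> (U i)) = a ! i"
    and "\<forall>i<length a. \<forall>j<length a. i \<noteq> j \<longrightarrow> (g i <#\<^bsub>G\<^esub> U i) \<inter> (g j <#\<^bsub>G\<^esub> U j) = {}"
    using assms(6) unfolding harmonic_def by (elim exE conjE)
  then have Ug: "\<And>i. i < n \<Longrightarrow> subgroup (U i) G" "\<And>i. i < n \<Longrightarrow> g i \<in> carrier G"
      "\<And>i. i < n \<Longrightarrow> finite (lcosets\<^bsub>G\<^esub> (U i))"
      "\<And>i j. i < n \<Longrightarrow> j < n \<Longrightarrow> i \<noteq> j \<Longrightarrow> (g i <#\<^bsub>G\<^esub> U i) \<inter> (g j <#\<^bsub>G\<^esub> U j) = {}"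
    and card: "\<And>i. i < n \<Longrightarrow> card (lcosets\<^bsub>G\<^esub> (U i)) = a ! i"
    using assms(4) by simp_all
  define V where "V = (\<lambda>i. if i < n then lcosets\<^bsub>G\<^esub> (U i) else {})"
  interpret two_configurations "(\<lambda>h C. h <#\<^bsub>G\<^esub> C) ` carrier G" V
    "\<lambda>C D. C \<inter> D \<noteq> {}" n "\<lambda>b i. if b then U i else g i <#\<^bsub>G\<^esub> U i"
    unfolding V_def by (rule two_configurations_of_cosets) (fact Ug)+
  (* Padding with 1 gives a tuple of length four: an entry 1 is coprime to all others and imposes nothing. *)
  define a' where "a' i = (if i < n then a ! i else 1)" for i
  have lt: "i < n" "j < n" if "gcd (a' i) (a' j) \<noteq> 1" for i j
    using that by (auto simp: a'_def split: if_splits)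
  have a': "card (V i) = a' i" if "i < n" for i
    using card that by (simp add: a'_def V_def)
  have "\<exists>m :: nat \<Rightarrow> int. \<forall>i<4. \<forall>j<4. i \<noteq> j \<longrightarrow> gcd (a' i) (a' j) \<noteq> 1 \<longrightarrow>
    \<not> int (gcd (a' i) (a' j)) dvd m i - m j"
  proof (rule separating_residues)
    show "0 < a' i" for i using assms(5) by (simp add: a'_def)
    show False if "distinct [i, j, k]" "gcd (a' i) (a' j) = 2" "gcd (a' j) (a' k) = 2" "gcd (a' i) (a' k) = 2" for i j k
    proof -
      have "i < n" "j < n" "k < n" using lt[of i j] lt[of j k] that by auto
      then show False using no_gcds_222[of i j k] that by (simp add: a')
    qed
    show "\<exists>i<4. \<exists>j<4. i \<noteq> j \<and> gcd (a' i) (a' j) \<noteq> 3"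
    proof (rule ccontr)
      assume "\<not> ?thesis"
      then have gcd: "gcd (a' i) (a' j) = 3" if "i < 4" "j < 4" "i \<noteq> j" for i j using that by blast
      then have "gcd (a' 3) (a' 0) = 3" by simp
      then have "3 < n" using lt[of 3 0] by simp
      then have n: "4 \<le> n" by simp
      show False
      proof (rule not_all_gcds_3[OF n])
        fix i j :: nat assume ij: "i < 4" "j < 4" "i \<noteq> j"
        then have "i < n" "j < n" using n by simp_all
        then show "gcd (card (V i)) (card (V j)) = 3"
          using gcd[OF ij] by (simp add: a')
      qed
    qed
    show False if "distinct [i, j, k, l]" "gcd (a' i) (a' j) = 4" "gcd (a' i) (a' k) = 4" "gcd (a' j) (a' k) = 4"
      "gcd (a' i) (a' l) = 2" "gcd (a' j) (a' l) = 2" "gcd (a' k) (a' l) = 2" for i j k l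
    proof -
      have "i < n" "j < n" "k < n" "l < n" using lt[of i j] lt[of k l] that by auto
      then show False using no_gcds_444222[of i j k l] that by (simp add: a')
    qed
  qed
  then obtain m :: "nat \<Rightarrow> int" where m: "\<And>i j. i < 4 \<Longrightarrow> j < 4 \<Longrightarrow> i \<noteq> j \<Longrightarrow> gcd (a' i) (a' j) \<noteq> 1 \<Longrightarrow>
    \<not> int (gcd (a' i) (a' j)) dvd m i - m j" by blast
  have "range (\<lambda>k. m i + int (a ! i) * k) \<inter> range (\<lambda>k. m j + int (a ! j) * k) = {}"
    if "i < length a" "j < length a" "i \<noteq> j" for i j
  proof (rule ccontr)
    have ij: "i < n" "j < n" "i \<noteq> j" using that assms(4) by simp_all
    assume "\<not> ?thesis"
    then obtain k k' where "m i + int (a ! i) * k = m j + int (a ! j) * k'" by blast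
    then have "m i - m j = int (a ! j) * k' - int (a ! i) * k" by simp
    moreover have "int (gcd (a ! i) (a ! j)) dvd int (a ! j) * k' - int (a ! i) * k"
      by (intro dvd_diff dvd_mult2) simp_all
    ultimately have "int (gcd (a' i) (a' j)) dvd m i - m j" using ij by (simp add: a'_def)
    moreover have "gcd (a' i) (a' j) \<noteq> 1" using not_coprime[OF ij] ij by (simp add: a')
    ultimately show False using m[of i j] ij assms(3) by simp
  qed
  note disjoint = this
  have pos: "\<forall>i<length a. a ! i > 0" using assms(4,5) by simp
  show ?thesis
    unfolding harmonic_integer_group_iff[OF pos] by (intro exI[of _ m] allI impI) (rule disjoint)
qed

end
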